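(* Suppose that the loss $L(\theta)$ is bounded from below by $L_{\inf}$ in some open subset of its domain, that $g$ is $C^1$ with respect to all variables, that the gradients of $g$ with respect to $\theta$ and $y$ are $L_\theta$- and $L_y$-Lipschitz, respectively, and that the second-order partial derivatives of $g$ with respect to $\theta$ exist. Let $\epsilon_p>0$ and suppose the approximate fixed points satisfy $\|(\tilde y_\theta(z)-z)+\nabla_y g_\theta(\tilde y_\theta(z))\|<\epsilon_p$ for all $\theta$ and $z$, and that $\int\|x\|^2\,d\mu(x)<\infty$ and $\int\|z\|^2\,d\nu(z)<\infty$. Suppose further that for some $0<V<1$, for all $\theta$ and all $z$, $$\|\tilde y_\theta(z)-y_\theta^*(z)\|<\epsilon\le\frac{V\,\|\nabla_\theta L(\theta)\|^2}{L_\theta\big(\sqrt{M_x}+\sqrt{M_z}\big)},$$ where $\epsilon$ does not depend on $z$ but may depend on $\theta$, and put $U=1-V$. Suppose the sequence of learning rates $\{\alpha_j\}_{j=0}^\infty$ is monotonically decreasing and satisfies $\sum_{j=0}^\infty\alpha_j=\infty$, $\sum_{j=0}^\infty\alpha_j^2<\infty$ and $0<\alpha_0\le\frac{UM_L}{L_\theta\tilde M}$. Let $A_K=\sum_{j=0}^{K-1}\alpha_j$. Then the SGD iteration $\theta_{j+1}=\theta_j-\alpha_j\tilde d_{\xi_j}(\theta_j)$, $j\ge0$, satisfies $$\lim_{K\to\infty}\mathbb{E}\Big[\frac1{A_K}\sum_{j=0}^{K}\alpha_j\,\|\nabla_\theta L(\theta_j)\|^2\Big]=0 .$$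
   Context: $\mu,\nu$ are probability measures on $\mathbb{R}^d$. $g:\mathbb{R}^p\times\mathbb{R}^d\to\mathbb{R}$, $(\theta,y)\mapsto g_\theta(y)$, is a parameterized potential with $\theta\in\mathbb{R}^p$, convex in $y$ for each $\theta$. Its gradients with respect to $\theta$ and $y$ are regarded as functions of $(\theta,y)$. $\frac{\partial g_\theta}{\partial\theta}(y)$ is the partial gradient in $\theta$ at fixed $y$. For $z\in\mathbb{R}^d$, $y_\theta^*(z)$ is the unique minimizer of $y\mapsto\frac12\|y-z\|^2+g_\theta(y)$, and $\tilde y_\theta(z)$ (measurable) is an approximation of it. The loss is $$L(\theta)=\mathbb{E}_{x\sim\mu}[g_\theta(x)]-\mathbb{E}_{z\sim\nu}\Big[\tfrac12\|y_\theta^*(z)-z\|^2+g_\theta(y_\theta^*(z))\Big],$$ whose gradient is $\nabla_\theta L(\theta)=\mathbb{E}_{x\sim\mu}\big[\frac{\partial g_\theta}{\partial\theta}(x)\big]-\mathbb{E}_{z\sim\nu}\big[\frac{\partial g_\theta}{\partial\theta}(y_\theta^*(z))\big]$. Constants: $M_x,M_z\in(0,\infty)$ are such that for all $\theta$: $\mathbb{E}_{x\sim\mu}\big[\|\frac{\partial g_\theta}{\partial\theta}(x)\|^2\big]<M_x$, $\mathbb{E}_{z\sim\nu}\big[\|\frac{\partial g_\theta}{\partial\theta}(\tilde y_\theta(z))\|^2\big]<M_z$, $\mathbb{E}_{z\sim\nu}\big[\|\frac{\partial g_\theta}{\partial\theta}(y_\theta^*(z))\|^2\big]<M_z$; $\tilde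 M=M_x+M_z+2\sqrt{M_xM_z}$; and $M_L\in(0,\infty)$ is such that $\|\nabla_\theta L(\theta)\|^2\le M_L$ for all $\theta$. SGD: $\xi_0,\xi_1,\dots$ are independent random variables; $\xi_j$ consists of i.i.d. samples $x_1,\dots,x_B\sim\mu$ and $z_1,\dots,z_B\sim\nu$ ($B\ge1$), and $\tilde d_{\xi_j}(\theta)=\frac1B\sum_{i=1}^B\frac{\partial g_\theta}{\partial\theta}(x_i)-\frac1B\sum_{i=1}^B\frac{\partial g_\theta}{\partial\theta}(\tilde y_\theta(z_i))$. $\alpha_j>0$ are deterministic learning rates and $\theta_0$ is given. $\mathbb{E}[\cdot]$ is the total expectation over all $\xi_0,\xi_1,\dots$ *)

theory Defs
  imports "HOL-Probability.Probability"
begin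

definition gradient :: "('a::euclidean_space \<Rightarrow> real) \<Rightarrow> 'a \<Rightarrow> 'a" where
  "gradient f x = (THE D. GDERIV f x :> D)"

definition grad_theta ::
  "(real^'p \<Rightarrow> real^'d \<Rightarrow> real) \<Rightarrow> real^'p \<Rightarrow> real^'d \<Rightarrow> real^'p" where
  "grad_theta g \<theta> y = gradient (\<lambda>t. g t y) \<theta>"

definition grad_y ::
  "(real^'p \<Rightarrow> real^'d \<Rightarrow> real) \<Rightarrow> real^'p \<Rightarrow> real^'d \<Rightarrow> real^'d" where
  "grad_y g \<theta> y = gradient (g \<theta>) y"

text \<open>The derivative is continuous with respect to the operator norm.\<close>

definition C1 :: "('a::real_normed_vector \<Rightarrow> 'b::real_normed_vector) \<Rightarrow> bool" where
  "C1 f \<longleftrightarrow> (\<exists>f' :: 'a \<Rightarrow> 'a \<Rightarrow>\<^sub>L 'b.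
     (\<forall>x. (f has_derivative blinfun_apply (f' x)) (at x)) \<and> continuous_on UNIV f')"

definition has_second_partials_theta :: "(real^'p \<Rightarrow> real^'d \<Rightarrow> real) \<Rightarrow> bool" where
  "has_second_partials_theta g \<longleftrightarrow>
     (\<forall>\<theta> y i j. (\<lambda>t::real. grad_theta g (\<theta> + t *\<^sub>R axis i 1) y $ j) differentiable (at 0))"

definition prox_objective ::
  "(real^'p \<Rightarrow> real^'d \<Rightarrow> real) \<Rightarrow> real^'p \<Rightarrow> real^'d \<Rightarrow> real^'d \<Rightarrow> real" where
  "prox_objective g \<theta> z y = 1 / 2 * (norm (y - z))\<^sup>2 + g \<theta> y"

text \<open>For convex differentiable \<open>g \<theta>\<close> the objective is strongly convex and continuous,
  so the minimizer exists and is unique.\<close>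

definition y_star ::
  "(real^'p \<Rightarrow> real^'d \<Rightarrow> real) \<Rightarrow> real^'p \<Rightarrow> real^'d \<Rightarrow> real^'d" where
  "y_star g \<theta> z = (THE y. is_arg_min (prox_objective g \<theta> z) (\<lambda>_. True) y)"

definition loss ::
  "(real^'d) measure \<Rightarrow> (real^'d) measure \<Rightarrow> (real^'p \<Rightarrow> real^'d \<Rightarrow> real) \<Rightarrow> real^'p \<Rightarrow> real" where
  "loss \<mu> \<nu> g \<theta> =
     (LINT x|\<mu>. g \<theta> x)
     - (LINT z|\<nu>. 1 / 2 * (norm (y_star g \<theta> z - z))\<^sup>2 + g \<theta> (y_star g \<theta> z))"

text \<open>A mini-batch is a pair of tuples \<open>((x\<^sub>1,\<dots>,x\<^sub>B), (z\<^sub>1,\<dots>,z\<^sub>B))\<close>.\<close>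

type_synonym 'd batch = "(nat \<Rightarrow> real^'d) \<times> (nat \<Rightarrow> real^'d)"

definition batch_space :: "nat \<Rightarrow> ('d::finite) batch measure" where
  "batch_space B = (\<Pi>\<^sub>M i\<in>{1..B}. borel) \<Otimes>\<^sub>M (\<Pi>\<^sub>M i\<in>{1..B}. borel)"

definition sgd_direction ::
  "(real^'p \<Rightarrow> real^'d \<Rightarrow> real) \<Rightarrow> (real^'p \<Rightarrow> real^'d \<Rightarrow> real^'d) \<Rightarrow> nat
   \<Rightarrow> 'd batch \<Rightarrow> real^'p \<Rightarrow> real^'p" where
  "sgd_direction g y_approx B s \<theta> =
     (1 / real B) *\<^sub>R (\<Sum>i=1..B. grad_theta g \<theta> (fst s i))
     - (1 / real B) *\<^sub>R (\<Sum>i=1..B. grad_theta g \<theta> (y_approx \<theta> (snd s i)))"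

text \<open>The batches \<open>\<xi> 0, \<xi> 1, \<dots>\<close> are independent; within a batch the \<open>x\<^sub>i\<close> are i.i.d.
  with law \<open>\<mu>\<close> and the \<open>z\<^sub>i\<close> are i.i.d. with law \<open>\<nu>\<close>.  No assumption is made on the
  joint law of the \<open>x\<close>- and the \<open>z\<close>-part of one batch, so sampling them independently
  of each other is a special case.\<close>

definition sgd_samples ::
  "'w measure \<Rightarrow> (real^'d) measure \<Rightarrow> (real^'d) measure \<Rightarrow> nat
   \<Rightarrow> (nat \<Rightarrow> 'w \<Rightarrow> ('d::finite) batch) \<Rightarrow> bool" where
  "sgd_samples P \<mu> \<nu> B \<xi> \<longleftrightarrow>
     prob_space.indep_vars P (\<lambda>_. batch_space B) \<xi> UNIV \<and>
     (\<forall>j. prob_space.indep_vars P (\<lambda>_. borel) (\<lambda>i w. fst (\<xi> j w) i) {1..B} \<and>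
          prob_space.indep_vars P (\<lambda>_. borel) (\<lambda>i w. snd (\<xi> j w) i) {1..B} \<and>
          (\<forall>i\<in>{1..B}. distr P borel (\<lambda>w. fst (\<xi> j w) i) = \<mu> \<and>
                      distr P borel (\<lambda>w. snd (\<xi> j w) i) = \<nu>))"

end

theory Submission
  imports Defs
begin

text \<open>The inner minimum \<open>env\<close> is a prox problem with a 1-strongly convex objective.  Comparing minimizers
  for two parameters shows that the loss agrees with its linearization, whose gradient is the expected
  difference of \<open>\<theta>\<close>-gradients, up to \<open>(2 L + L\<^sup>2) \<bar>\<delta>\<bar>\<^sup>2\<close>; this gives differentiability and the descent
  inequality at once.  Kantorovich weak duality bounds the loss from below on the whole space by the
  second moments.  The error bound on the approximate minimizer makes the mean direction have inner
  product at least \<open>(1 - V) \<bar>G\<bar>\<^sup>2\<close> with the gradient \<open>G\<close>, and the second moment of the stochastic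
  direction is uniformly bounded.  As a batch is independent of the past, the expected loss drops by
  \<open>\<alpha>\<^sub>j (1 - V) E \<bar>G\<^sub>j\<bar>\<^sup>2\<close> up to \<open>O(\<alpha>\<^sub>j\<^sup>2)\<close>, so \<open>\<Sum>\<^sub>j \<alpha>\<^sub>j E \<bar>G\<^sub>j\<bar>\<^sup>2\<close> is finite and division by \<open>A\<^sub>K\<close>
  sends it to zero.\<close>

section \<open>Gradients and prox objectives\<close>

lemma GDERIV_unique:
  assumes "GDERIV f x :> D" and "GDERIV f x :> D'"
  shows "D = D'"
proof -
  have "inner h D = inner h D'" for h
    using has_derivative_unique[OF assms[unfolded gderiv_def]] by meson
  from this[of "D - D'"] have "inner (D - D') (D - D') = 0" by (simp add: inner_diff_right)
  then show ?thesis by simp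
qed

lemma gradient_eqI: "GDERIV f x :> D \<Longrightarrow> gradient f x = D"
  unfolding gradient_def by (rule the_equality) (blast dest: GDERIV_unique)+

text \<open>Riesz representation in coordinates: the derivative is the inner product with the vector
  of its values on the basis. Hence the \<open>THE\<close> in \<open>gradient\<close> is well
  defined at every point of differentiability.\<close>

lemma GDERIV_gradient:
  fixes f :: "'a::euclidean_space \<Rightarrow> real"
  assumes "(f has_derivative f') (at x)"
  shows "GDERIV f x :> gradient f x"
proof -
  interpret bounded_linear f' using assms by (rule has_derivative_bounded_linear)
  have "f' h = inner h (\<Sum>b\<in>Basis. f' b *\<^sub>R b)" for h
  proof -
    have "f' h = f' (\<Sum>b\<in>Basis. inner h b *\<^sub>R b)" by (simp add: euclidean_representation)
    also have "\<dots> = (\<Sum>b\<in>Basis. inner h b * f' b)" by (simp add: sum scaleR)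
    finally show ?thesis by (simp add: inner_sum_right mult.commute)
  qed
  then have "f' = (\<lambda>h. inner h (\<Sum>b\<in>Basis. f' b *\<^sub>R b))" by blast
  then have "GDERIV f x :> (\<Sum>b\<in>Basis. f' b *\<^sub>R b)"
    using assms unfolding gderiv_def by metis
  then show ?thesis using gradient_eqI by metis
qed

text \<open>Mean value inequality for \<open>f\<close> minus its linearization at \<open>x\<close>,
  whose derivative on the segment is at most \<open>L * norm h\<close>. Bounding by this supremum
  gives the constant \<open>L\<close> in place of the sharp \<open>L / 2\<close>.\<close>

lemma lipschitz_gradient_remainder:
  fixes f :: "'a::real_inner \<Rightarrow> real"
  assumes deriv: "\<And>x. GDERIV f x :> G x" and lip: "L-lipschitz_on UNIV G"
  shows "\<bar>f (x + h) - f x - inner h (G x)\<bar> \<le> L * (norm h)\<^sup>2"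
proof -
  let ?f = "\<lambda>y. f y - inner y (G x)"
  have "norm (?f (x + h) - ?f x) \<le> L * norm h * norm (x + h - x)"
  proof (rule differentiable_bound[of "closed_segment x (x + h)"])
    fix y assume y: "y \<in> closed_segment x (x + h)"
    have "(?f has_derivative (\<lambda>k. inner k (G y) - inner k (G x))) (at y)"
      using deriv[of y] unfolding gderiv_def
      by (rule has_derivative_diff)
         (rule bounded_linear_imp_has_derivative[OF bounded_linear_inner_left])
    then show "(?f has_derivative (\<lambda>k. inner k (G y - G x))) (at y within closed_segment x (x + h))"
      unfolding inner_diff_right by (rule has_derivative_at_withinI)
    have "norm (G y - G x) \<le> L * norm (y - x)"
      using lipschitz_onD[OF lip] by (simp add: dist_norm)
    also have "\<dots> \<le> L * norm h"
      using segment_bound(1)[OF y] lipschitz_on_nonneg[OF lip] by (intro mult_left_mono) auto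
    finally have "norm k * norm (G y - G x) \<le> L * norm h * norm k" for k :: 'a
      by (simp add: mult.commute mult_left_mono)
    then show "onorm (\<lambda>k. inner k (G y - G x)) \<le> L * norm h"
      using lipschitz_on_nonneg[OF lip]
      by (intro onorm_bound) (auto intro: order_trans[OF Cauchy_Schwarz_ineq2])
  qed auto
  then show ?thesis by (simp add: inner_add_left power2_eq_square algebra_simps)
qed

section \<open>Minimizers of prox objectives\<close>

lemma convex_on_affine_lower_bound:
  fixes f :: "'a::euclidean_space \<Rightarrow> real"
  assumes "convex_on UNIV f"
  obtains c where "\<And>y. - c * (1 + norm y) \<le> f y"
proof -
  have "continuous_on (cball 0 1) f"
    using convex_on_continuous[OF open_UNIV assms] continuous_on_subset by blast
  then obtain y0 where y0: "\<And>y. y \<in> cball 0 1 \<Longrightarrow> f y0 \<le> f y"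
    using continuous_attains_inf[of "cball 0 1" f] by force
  define c where "c = \<bar>f y0\<bar> + \<bar>f 0\<bar>"
  have "c \<ge> 0" unfolding c_def by simp
  have "- c * (1 + norm y) \<le> f y" for y
  proof (cases "norm y \<le> 1")
    case True
    then have "- c \<le> f y" using y0[of y] unfolding c_def by simp
    moreover have "0 \<le> c * norm y" using \<open>c \<ge> 0\<close> by simp
    ultimately show ?thesis by (simp add: algebra_simps)
  next
    case False
    let ?t = "1 / norm y"
    have t: "0 \<le> ?t" "?t \<le> 1" "norm y > 0" using False by (auto simp: divide_le_eq_1 not_le)
    \<comment> \<open>The point \<open>?t *\<^sub>R y\<close> of the unit sphere lies between
      \<open>0\<close> and \<open>y\<close>, so convexity carries the lower bound on the ball
      outward with an at most linear loss.\<close>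
    have "f y0 \<le> f (?t *\<^sub>R y)" using t by (intro y0) simp
    also have "\<dots> \<le> (1 - ?t) * f 0 + ?t * f y"
      using convex_onD[OF assms t(1,2), of 0 y] by simp
    finally have "norm y * f y0 \<le> norm y * ((1 - ?t) * f 0 + ?t * f y)"
      by (simp add: mult_left_mono)
    also have "\<dots> = (norm y - 1) * f 0 + f y" using t by (simp add: field_simps)
    also have "\<dots> \<le> norm y * \<bar>f 0\<bar> + f y"
    proof -
      have "(norm y - 1) * f 0 \<le> (norm y - 1) * \<bar>f 0\<bar>"
        using False by (intro mult_left_mono) auto
      then show ?thesis by (simp add: left_diff_distrib)
    qed
    finally have "norm y * f y0 \<le> norm y * \<bar>f 0\<bar> + f y" .
    moreover have "norm y * - \<bar>f y0\<bar> \<le> norm y * f y0" by (intro mult_left_mono) auto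
    ultimately show ?thesis using \<open>c \<ge> 0\<close> unfolding c_def by (simp add: algebra_simps)
  qed
  then show thesis by (rule that)
qed

text \<open>The quadratic part makes the objective 1-strongly convex. The minimizer is compared with
  points of the segment towards \<open>u\<close>; dividing by \<open>t\<close> and letting
  \<open>t\<close> tend to \<open>0\<close> leaves the full quadratic gain.\<close>

lemma prox_objective_growth:
  assumes conv: "convex_on UNIV (g \<theta>)"
    and min: "is_arg_min (prox_objective g \<theta> z) (\<lambda>_. True) y"
  shows "prox_objective g \<theta> z y + 1 / 2 * (norm (u - y))\<^sup>2 \<le> prox_objective g \<theta> z u"
proof -
  let ?f = "prox_objective g \<theta> z"
  have *: "(1 - t) * (1 / 2 * (norm (u - y))\<^sup>2) \<le> ?f u - ?f y" if t: "0 < t" "t < 1" for t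
  proof -
    let ?v = "(1 - t) *\<^sub>R y + t *\<^sub>R u"
    define a b where "a = y - z" and "b = u - y"
    have v: "?v - z = a + t *\<^sub>R b" "u - z = a + b" "y - z = a" "u - y = b"
      by (simp_all add: a_def b_def algebra_simps)
    have "?f y \<le> ?f ?v" using min by (auto simp: is_arg_min_linorder)
    also have "\<dots> \<le> 1 / 2 * (norm (?v - z))\<^sup>2 + ((1 - t) * g \<theta> y + t * g \<theta> u)"
      unfolding prox_objective_def using convex_onD[OF conv, of t y u] t by simp
    \<comment> \<open>This uses
      \<open>|a + t b|^2 = (1 - t) |a|^2 + t |a + b|^2 - t (1 - t) |b|^2\<close>; the last term is
      the gain.\<close>
    also have "\<dots> = ?f y + t * (?f u - ?f y) - t * ((1 - t) * (1 / 2 * (norm (u - y))\<^sup>2))"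
      unfolding prox_objective_def v power2_norm_eq_inner
      by (simp add: inner_add_left inner_add_right inner_commute[of b a] field_simps)
    finally have "t * ((1 - t) * (1 / 2 * (norm (u - y))\<^sup>2)) \<le> t * (?f u - ?f y)" by simp
    then show ?thesis using t by simp
  qed
  have "((\<lambda>t. (1 - t) * (1 / 2 * (norm (u - y))\<^sup>2)) \<longlongrightarrow> (1 - 0) * (1 / 2 * (norm (u - y))\<^sup>2))
          (at_right 0)"
    by (intro tendsto_intros)
  then have "(1 - 0) * (1 / 2 * (norm (u - y))\<^sup>2) \<le> ?f u - ?f y"
    using * by (rule tendsto_upperbound[OF _ eventually_at_rightI[of 0 1]]) auto
  then show ?thesis by simp
qed

text \<open>Coercivity gives existence: far from \<open>z\<close> the quadratic term beats the
  affine lower bound on \<open>g \<theta>\<close>, so a minimizer over a large ball is global. The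
  growth inequality gives uniqueness, which makes the \<open>THE\<close> in \<open>y_star\<close>
  meaningful.\<close>

lemma y_star_is_arg_min:
  assumes conv: "convex_on UNIV (g \<theta>)"
  shows "is_arg_min (prox_objective g \<theta> z) (\<lambda>_. True) (y_star g \<theta> z)"
proof -
  let ?f = "prox_objective g \<theta> z"
  have cont: "continuous_on S ?f" for S
    unfolding prox_objective_def
    by (intro continuous_intros continuous_on_subset[OF convex_on_continuous[OF open_UNIV conv]]) auto
  obtain c where c: "\<And>y. - c * (1 + norm y) \<le> g \<theta> y"
    using convex_on_affine_lower_bound[OF conv] by blast
  \<comment> \<open>At distance \<open>r > R\<close> from \<open>z\<close>, half of
    \<open>r * r\<close> exceeds half of \<open>R * r\<close>, which covers both the affine lower
    bound at \<open>y\<close> and the value \<open>g \<theta> z\<close>. The summand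
    \<open>1\<close> ensures \<open>r \<ge> 1\<close>, so that constants may be multiplied by
    \<open>r\<close>.\<close>
  define R where "R = 2 * \<bar>c\<bar> * (2 + norm z) + 2 * \<bar>g \<theta> z\<bar> + 1"
  have R: "R \<ge> 1" unfolding R_def by simp
  have far: "?f z \<le> ?f y" if "norm (y - z) > R" for y
  proof -
    let ?r = "norm (y - z)"
    have r: "?r \<ge> 1" using that R by simp
    have "norm y \<le> ?r + norm z" by (metis diff_add_cancel norm_triangle_ineq)
    also have "\<dots> \<le> ?r + ?r * norm z" using mult_right_mono[OF r norm_ge_zero[of z]] by simp
    finally have "\<bar>c\<bar> * (1 + norm y) \<le> \<bar>c\<bar> * (?r * (2 + norm z))"
      using r by (intro mult_left_mono) (auto simp: algebra_simps)
    moreover have "- c * (1 + norm y) \<ge> - \<bar>c\<bar> * (1 + norm y)" by (intro mult_right_mono) auto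
    moreover have "\<bar>g \<theta> z\<bar> \<le> \<bar>g \<theta> z\<bar> * ?r" using mult_left_mono[OF r abs_ge_zero[of "g \<theta> z"]] by simp
    moreover have "R * ?r \<le> ?r * ?r" using that by (intro mult_right_mono) auto
    moreover have "R * ?r = 2 * (\<bar>c\<bar> * (?r * (2 + norm z))) + 2 * (\<bar>g \<theta> z\<bar> * ?r) + ?r"
      unfolding R_def by (simp add: algebra_simps)
    ultimately have "g \<theta> z \<le> 1 / 2 * (?r * ?r) + g \<theta> y"
      using c[of y] r by linarith
    then show ?thesis by (simp add: prox_objective_def power2_eq_square)
  qed
  obtain y where y: "\<And>u. u \<in> cball z R \<Longrightarrow> ?f y \<le> ?f u"
    using continuous_attains_inf[of "cball z R" ?f] cont R by force
  have "?f y \<le> ?f u" for u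
  proof (cases "norm (u - z) \<le> R")
    case True then show ?thesis by (intro y) (simp add: dist_norm norm_minus_commute)
  next
    case False
    then show ?thesis using far[of u] y[of z] R by force
  qed
  then have y: "is_arg_min ?f (\<lambda>_. True) y" by (simp add: is_arg_min_linorder)
  moreover have "u = y" if u: "is_arg_min ?f (\<lambda>_. True) u" for u
  proof -
    have "?f u \<le> ?f y" using u by (simp add: is_arg_min_linorder)
    then have "(norm (u - y))\<^sup>2 \<le> 0" using prox_objective_growth[of g \<theta> z y u, OF conv y] by linarith
    then have "norm (u - y) = 0" by simp
    then show ?thesis by simp
  qed
  ultimately show ?thesis unfolding y_star_def by (rule theI)
qed

lemma y_star_growth:
  assumes "convex_on UNIV (g \<theta>)"
  shows "prox_objective g \<theta> z (y_star g \<theta> z) + 1 / 2 * (norm (u - y_star g \<theta> z))\<^sup>2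
           \<le> prox_objective g \<theta> z u"
  using assms by (intro prox_objective_growth y_star_is_arg_min)

text \<open>Each minimizer is tested in the growth inequality of the other. In the sum the values of
  \<open>g\<close> cancel, and the squares polarize to an inner product: the prox map is firmly
  nonexpansive, and Cauchy-Schwarz finishes.\<close>

lemma y_star_nonexpansive:
  fixes g :: "real^'a \<Rightarrow> real^'b \<Rightarrow> real"
  assumes "convex_on UNIV (g \<theta>)"
  shows "norm (y_star g \<theta> z - y_star g \<theta> z') \<le> norm (z - z')"
proof -
  let ?y = "y_star g \<theta> z" and ?y' = "y_star g \<theta> z'"
  have polar: "(norm (b - z))\<^sup>2 - (norm (a - z))\<^sup>2 + ((norm (a - z'))\<^sup>2 - (norm (b - z'))\<^sup>2)
      = 2 * inner (a - b) (z - z')" for a b :: "real^'b"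
    unfolding power2_norm_eq_inner by (simp add: inner_diff_left inner_diff_right inner_commute)
  have "(norm (?y - ?y'))\<^sup>2 \<le> inner (?y - ?y') (z - z')"
    using y_star_growth[of g \<theta> z ?y', OF assms] y_star_growth[of g \<theta> z' ?y, OF assms]
      polar[of ?y' ?y] norm_minus_commute[of ?y ?y']
    unfolding prox_objective_def by simp
  also have "\<dots> \<le> norm (?y - ?y') * norm (z - z')" by (rule norm_cauchy_schwarz)
  finally show ?thesis
    by (cases "norm (?y - ?y') = 0") (auto simp: power2_eq_square)
qed

section \<open>The loss\<close>

lemma GDERIV_quadratic_remainder:
  fixes f :: "'a::real_inner \<Rightarrow> real"
  assumes rem: "\<And>h. \<bar>f (x + h) - f x - inner h D\<bar> \<le> K * (norm h)\<^sup>2"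
  shows "GDERIV f x :> D"
  unfolding gderiv_def has_derivative_at
proof (intro conjI bounded_linear_inner_left)
  have "\<bar>norm (f (x + h) - f x - inner h D) / norm h\<bar> \<le> K * norm h" for h
    using rem[of h] by (cases "h = 0") (auto simp: field_simps power2_eq_square)
  then have "\<forall>\<^sub>F h in at 0. norm (norm (f (x + h) - f x - inner h D) / norm h) \<le> K * norm h" by simp
  moreover have "((\<lambda>h. K * norm h) \<longlongrightarrow> 0) (at (0::'a))"
    by (intro tendsto_mult_right_zero tendsto_norm_zero tendsto_ident_at)
  ultimately show "((\<lambda>h. norm (f (x + h) - f x - inner h D) / norm h) \<longlongrightarrow> 0) (at 0)"
    by (rule Lim_null_comparison)
qed

text \<open>Each coordinate of \<open>G\<close> is a pointwise limit of difference quotients of the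
  continuous function \<open>f\<close>; with step \<open>1 / Suc n\<close> the error is at most
  \<open>K / Suc n\<close>. For the loss this makes the gradient at a random iterate a random
  variable.\<close>

lemma borel_measurable_gradient:
  fixes f :: "'a::euclidean_space \<Rightarrow> real"
  assumes rem: "\<And>x h. \<bar>f (x + h) - f x - inner h (G x)\<bar> \<le> K * (norm h)\<^sup>2"
  shows "f \<in> borel_measurable borel" and "G \<in> borel_measurable borel"
proof -
  have "continuous (at x) f" for x
    using GDERIV_quadratic_remainder[OF rem] unfolding gderiv_def by (rule has_derivative_continuous)
  then have cont: "continuous_on UNIV f" by (simp add: continuous_at_imp_continuous_on)
  then show f [measurable]: "f \<in> borel_measurable borel" by (rule borel_measurable_continuous_onI)
  have "(\<lambda>x. inner (G x) b) \<in> borel_measurable borel" if b: "b \<in> Basis" for b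
  proof (rule borel_measurable_LIMSEQ_real)
    fix x
    let ?q = "\<lambda>n. real (Suc n) * (f (x + (1 / real (Suc n)) *\<^sub>R b) - f x)"
    have "norm (?q n - inner (G x) b) \<le> K * (1 / real (Suc n))" for n
    proof -
      have "norm (?q n - inner (G x) b)
          = real (Suc n) * \<bar>f (x + (1 / real (Suc n)) *\<^sub>R b) - f x
              - inner ((1 / real (Suc n)) *\<^sub>R b) (G x)\<bar>"
      proof -
        have "?q n - inner (G x) b = real (Suc n) * (f (x + (1 / real (Suc n)) *\<^sub>R b) - f x
              - inner ((1 / real (Suc n)) *\<^sub>R b) (G x))"
          by (simp add: right_diff_distrib inner_commute del: of_nat_Suc)
        then show ?thesis by (simp add: abs_mult del: of_nat_Suc)
      qed
      also have "\<dots> \<le> real (Suc n) * (K * (norm ((1 / real (Suc n)) *\<^sub>R b))\<^sup>2)"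
        by (intro mult_left_mono rem) auto
      also have "\<dots> = K * (1 / real (Suc n))"
        using b by (simp add: power2_eq_square del: of_nat_Suc)
      finally show ?thesis .
    qed
    then have "\<forall>\<^sub>F n in sequentially. norm (?q n - inner (G x) b) \<le> K * (1 / real (Suc n))"
      by (rule always_eventually[OF allI])
    moreover have "(\<lambda>n. K * (1 / real (Suc n))) \<longlonglongrightarrow> 0"
      using tendsto_mult[OF tendsto_const LIMSEQ_inverse_real_of_nat, of K]
      by (simp add: inverse_eq_divide)
    ultimately have "(\<lambda>n. ?q n - inner (G x) b) \<longlonglongrightarrow> 0"
      by (rule Lim_null_comparison)
    then show "?q \<longlonglongrightarrow> inner (G x) b" by (rule LIM_zero_cancel)
  qed measurable
  then show "G \<in> borel_measurable borel"
    using borel_measurable_euclidean_space by blast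
qed

text \<open>Jensen's inequality, read off from the nonnegativity of the variance of
  \<open>norm (f x)\<close>.\<close>

lemma (in prob_space) norm_integral_le_sqrt:
  fixes f :: "'a \<Rightarrow> 'b::euclidean_space"
  assumes f: "f \<in> borel_measurable M" and int: "integrable M (\<lambda>x. (norm (f x))\<^sup>2)"
    and le: "(LINT x|M. (norm (f x))\<^sup>2) \<le> m"
  shows "integrable M f" and "norm (LINT x|M. f x) \<le> sqrt m"
proof -
  have norm: "integrable M (\<lambda>x. norm (f x))"
    using int by (rule square_integrable_imp_integrable[rotated]) (use f in measurable)
  then show "integrable M f" using f integrable_norm_iff by blast
  have "norm (LINT x|M. f x) \<le> (LINT x|M. norm (f x))" by (rule integral_norm_bound)
  also have "(LINT x|M. norm (f x))\<^sup>2 \<le> (LINT x|M. (norm (f x))\<^sup>2)"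
    using variance_eq[OF norm int] variance_positive[of "\<lambda>x. norm (f x)"] by simp
  then have "(LINT x|M. norm (f x)) \<le> sqrt m" using le by (intro real_le_rsqrt) simp
  finally show "norm (LINT x|M. f x) \<le> sqrt m" .
qed

lemma norm_mean_squared_le:
  fixes u :: "'i \<Rightarrow> 'a::real_normed_vector"
  assumes "finite I" and "I \<noteq> {}"
  shows "(norm ((1 / real (card I)) *\<^sub>R (\<Sum>i\<in>I. u i)))\<^sup>2 \<le> 1 / real (card I) * (\<Sum>i\<in>I. (norm (u i))\<^sup>2)"
proof -
  have card: "real (card I) > 0" using assms by (simp add: card_gt_0_iff)
  have "(norm (\<Sum>i\<in>I. u i))\<^sup>2 \<le> (\<Sum>i\<in>I. norm (u i))\<^sup>2"
    by (intro power_mono norm_sum) auto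
  also have "\<dots> \<le> (\<Sum>i\<in>I. (norm (u i))\<^sup>2) * real (card I)"
    using assms sum_squared_le_sum_of_squares by blast
  finally show ?thesis using card by (simp add: field_simps power2_eq_square)
qed

section \<open>Smoothness of the potential and of its envelope\<close>

locale lipschitz_potential =
  fixes g :: "real^'p \<Rightarrow> real^'d \<Rightarrow> real" and L L\<^sub>y :: real
  assumes convex: "convex_on UNIV (g \<theta>)"
    and C1: "C1 (\<lambda>(\<theta>, y). g \<theta> y)"
    and lip_theta: "L-lipschitz_on UNIV (\<lambda>(\<theta>, y). grad_theta g \<theta> y)"
    and lip_y: "L\<^sub>y-lipschitz_on UNIV (\<lambda>(\<theta>, y). grad_y g \<theta> y)"
begin

lemma L_nonneg: "0 \<le> L"
  using lip_theta by (rule lipschitz_on_nonneg)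

lemma GDERIV_theta: "GDERIV (\<lambda>t. g t y) \<theta> :> grad_theta g \<theta> y"
  and GDERIV_y: "GDERIV (g \<theta>) y :> grad_y g \<theta> y"
proof -
  obtain f' where f': "((\<lambda>(\<theta>, y). g \<theta> y) has_derivative f') (at (\<theta>, y))"
    using C1 unfolding C1_def by blast
  have "((\<lambda>t. (t, y)) has_derivative (\<lambda>h. (h, 0))) (at \<theta>)"
    by (intro derivative_intros)
  from has_derivative_compose[OF this f'] show "GDERIV (\<lambda>t. g t y) \<theta> :> grad_theta g \<theta> y"
    unfolding grad_theta_def by (auto intro: GDERIV_gradient)
  have "((\<lambda>u. (\<theta>, u)) has_derivative (\<lambda>h. (0, h))) (at y)"
    by (intro derivative_intros)
  from has_derivative_compose[OF this f'] show "GDERIV (g \<theta>) y :> grad_y g \<theta> y"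
    unfolding grad_y_def by (auto intro: GDERIV_gradient)
qed

lemma g_remainder_theta:
  "\<bar>g (\<theta> + \<delta>) y - g \<theta> y - inner \<delta> (grad_theta g \<theta> y)\<bar> \<le> L * (norm \<delta>)\<^sup>2"
proof (rule lipschitz_gradient_remainder[where f = "\<lambda>t. g t y"])
  show "L-lipschitz_on UNIV (\<lambda>t. grad_theta g t y)"
  proof (rule lipschitz_onI[OF _ L_nonneg])
    fix s t
    show "dist (grad_theta g s y) (grad_theta g t y) \<le> L * dist s t"
      using lipschitz_onD[OF lip_theta, of "(s, y)" "(t, y)"] by (simp add: dist_Pair_Pair)
  qed
qed (rule GDERIV_theta)

lemma g_remainder_y:
  "\<bar>g \<theta> (y + h) - g \<theta> y - inner h (grad_y g \<theta> y)\<bar> \<le> L\<^sub>y * (norm h)\<^sup>2"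
proof (rule lipschitz_gradient_remainder[where f = "g \<theta>"])
  show "L\<^sub>y-lipschitz_on UNIV (grad_y g \<theta>)"
  proof (rule lipschitz_onI[OF _ lipschitz_on_nonneg[OF lip_y]])
    fix u v
    show "dist (grad_y g \<theta> u) (grad_y g \<theta> v) \<le> L\<^sub>y * dist u v"
      using lipschitz_onD[OF lip_y, of "(\<theta>, u)" "(\<theta>, v)"] by (simp add: dist_Pair_Pair)
  qed
qed (rule GDERIV_y)

lemma grad_theta_lipschitz:
  "norm (grad_theta g \<theta> u - grad_theta g \<theta> v) \<le> L * norm (u - v)"
  using lipschitz_onD[OF lip_theta, of "(\<theta>, u)" "(\<theta>, v)"] by (simp add: dist_Pair_Pair dist_norm)

lemma borel_measurable_grad_theta:
  "(\<lambda>(\<theta>, y). grad_theta g \<theta> y) \<in> borel_measurable (borel \<Otimes>\<^sub>M borel)"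
  using lipschitz_on_continuous_on[OF lip_theta]
  unfolding borel_prod by (rule borel_measurable_continuous_onI)

lemma borel_measurable_grad_theta_fixed [measurable]: "grad_theta g \<theta> \<in> borel_measurable borel"
  using measurable_compose[OF measurable_Pair1' borel_measurable_grad_theta, of \<theta>] by simp

lemma borel_measurable_g [measurable]: "g \<theta> \<in> borel_measurable borel"
  using convex_on_continuous[OF open_UNIV convex] by (rule borel_measurable_continuous_onI)

lemma borel_measurable_y_star [measurable]: "y_star g \<theta> \<in> borel_measurable borel"
proof -
  have "1-lipschitz_on UNIV (y_star g \<theta>)"
    using y_star_nonexpansive[of g \<theta>, OF convex] by (intro lipschitz_onI) (auto simp: dist_norm)
  then show ?thesis by (intro borel_measurable_continuous_onI lipschitz_on_continuous_on)
qed

text \<open>The remainder bound in \<open>y\<close> around \<open>0\<close> compares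
  \<open>g \<theta>\<close> with an affine function, and the linear term is absorbed by the square.
  Finite second moments then yield integrability.\<close>

lemma g_quadratic_growth:
  obtains c where "\<And>y. \<bar>g \<theta> y\<bar> \<le> c * (1 + (norm y)\<^sup>2)" and "c \<ge> 0"
proof
  let ?c = "\<bar>g \<theta> 0\<bar> + norm (grad_y g \<theta> 0) + L\<^sub>y"
  have Ly: "L\<^sub>y \<ge> 0" using lip_y by (rule lipschitz_on_nonneg)
  fix y :: "real^'d"
  have "2 * norm y \<le> 1 + (norm y)\<^sup>2"
    using sum_squares_bound[of 1 "norm y"] by simp
  then have "norm y \<le> 1 + (norm y)\<^sup>2" using norm_ge_zero[of y] by linarith
  then have "norm (grad_y g \<theta> 0) * norm y \<le> norm (grad_y g \<theta> 0) * (1 + (norm y)\<^sup>2)"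
    by (rule mult_left_mono) simp
  moreover have "\<bar>inner y (grad_y g \<theta> 0)\<bar> \<le> norm (grad_y g \<theta> 0) * norm y"
    using Cauchy_Schwarz_ineq2[of y "grad_y g \<theta> 0"] by (simp add: mult.commute)
  moreover have "0 \<le> \<bar>g \<theta> 0\<bar> * (norm y)\<^sup>2" by simp
  ultimately show "\<bar>g \<theta> y\<bar> \<le> ?c * (1 + (norm y)\<^sup>2)"
    using g_remainder_y[of \<theta> 0 y] Ly
    unfolding distrib_right distrib_left add_0_left mult_1_right by linarith
  show "?c \<ge> 0" using Ly by simp
qed

text \<open>The Moreau envelope of \<open>g \<theta>\<close> with parameter 1; its expectation under
  \<open>\<nu>\<close> is the second term of the loss.\<close>

definition env :: "real^'p \<Rightarrow> real^'d \<Rightarrow> real" where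
  "env \<theta> z = prox_objective g \<theta> z (y_star g \<theta> z)"

lemma env_le: "env \<theta> z \<le> prox_objective g \<theta> z u"
  using y_star_growth[of g \<theta> z u, OF convex] zero_le_power2[of "norm (u - y_star g \<theta> z)"]
  unfolding env_def by linarith

lemma borel_measurable_env [measurable]: "env \<theta> \<in> borel_measurable borel"
  unfolding env_def prox_objective_def by measurable

text \<open>In the lower bound, moving the minimizer costs \<open>L \<bar>y - y'\<bar> \<bar>\<delta>\<bar>\<close> in the linear term, which the
  strong convexity gain \<open>\<bar>y - y'\<bar>\<^sup>2 / 2\<close> absorbs.\<close>

lemma env_remainder:
  "\<bar>env (\<theta> + \<delta>) z - env \<theta> z - inner \<delta> (grad_theta g \<theta> (y_star g \<theta> z))\<bar> \<le> (L + L\<^sup>2) * (norm \<delta>)\<^sup>2"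
proof -
  let ?y = "y_star g \<theta> z" and ?y' = "y_star g (\<theta> + \<delta>) z"
  let ?d = "norm (?y' - ?y)"
  \<comment> \<open>As in Danskin's theorem, freezing the old minimizer in the new problem gives the
    upper bound directly.\<close>
  have "env (\<theta> + \<delta>) z \<le> prox_objective g (\<theta> + \<delta>) z ?y" by (rule env_le)
  then have upper: "env (\<theta> + \<delta>) z - env \<theta> z - inner \<delta> (grad_theta g \<theta> ?y) \<le> L * (norm \<delta>)\<^sup>2"
    using g_remainder_theta[of \<theta> \<delta> ?y] unfolding env_def prox_objective_def by simp
  have "env \<theta> z + 1 / 2 * ?d\<^sup>2 \<le> prox_objective g \<theta> z ?y'"
    using y_star_growth[of g \<theta> z ?y', OF convex] unfolding env_def .
  then have "env \<theta> z + 1 / 2 * ?d\<^sup>2 + inner \<delta> (grad_theta g \<theta> ?y') - L * (norm \<delta>)\<^sup>2 \<le> env (\<theta> + \<delta>) z"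
    using g_remainder_theta[of \<theta> \<delta> ?y'] unfolding env_def prox_objective_def by simp
  moreover have "inner \<delta> (grad_theta g \<theta> ?y) - inner \<delta> (grad_theta g \<theta> ?y')
      \<le> 1 / 2 * ?d\<^sup>2 + 1 / 2 * (L\<^sup>2 * (norm \<delta>)\<^sup>2)"
  proof -
    have "inner \<delta> (grad_theta g \<theta> ?y) - inner \<delta> (grad_theta g \<theta> ?y')
        \<le> norm \<delta> * norm (grad_theta g \<theta> ?y - grad_theta g \<theta> ?y')"
      unfolding inner_diff_right[symmetric] by (rule norm_cauchy_schwarz)
    also have "\<dots> \<le> norm \<delta> * (L * ?d)"
      using grad_theta_lipschitz[of \<theta> ?y ?y'] by (intro mult_left_mono) (auto simp: norm_minus_commute)
    \<comment> \<open>Young's inequality, weighted so that the coefficient of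
      \<open>?d\<^sup>2\<close> equals the available gain.\<close>
    also have "\<dots> \<le> 1 / 2 * ?d\<^sup>2 + 1 / 2 * (L\<^sup>2 * (norm \<delta>)\<^sup>2)"
      using sum_squares_bound[of ?d "L * norm \<delta>"] by (simp add: power_mult_distrib mult.commute mult.left_commute)
    finally show ?thesis .
  qed
  moreover have "0 \<le> L\<^sup>2 * (norm \<delta>)\<^sup>2" by simp
  ultimately show ?thesis using upper unfolding abs_le_iff distrib_right by linarith
qed

end

section \<open>Expected loss: gradient formula and lower bound\<close>

locale prox_loss = lipschitz_potential g L L\<^sub>y + mu: prob_space \<mu> + nu: prob_space \<nu>
  for g :: "real^'p \<Rightarrow> real^'d \<Rightarrow> real" and L L\<^sub>y :: real and \<mu> \<nu> :: "(real^'d) measure" +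
  fixes M\<^sub>x M\<^sub>z :: real
  assumes sets_mu [measurable_cong]: "sets \<mu> = sets borel"
    and sets_nu [measurable_cong]: "sets \<nu> = sets borel"
    and moment_mu: "integrable \<mu> (\<lambda>x. (norm x)\<^sup>2)"
    and moment_nu: "integrable \<nu> (\<lambda>z. (norm z)\<^sup>2)"
    and grad_mu: "integrable \<mu> (\<lambda>x. (norm (grad_theta g \<theta> x))\<^sup>2)"
      "(LINT x|\<mu>. (norm (grad_theta g \<theta> x))\<^sup>2) \<le> M\<^sub>x"
    and grad_nu: "integrable \<nu> (\<lambda>z. (norm (grad_theta g \<theta> (y_star g \<theta> z)))\<^sup>2)"
      "(LINT z|\<nu>. (norm (grad_theta g \<theta> (y_star g \<theta> z)))\<^sup>2) \<le> M\<^sub>z"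
begin

lemma integrable_g: "integrable \<mu> (g \<theta>)"
proof -
  obtain c where c: "\<And>y. \<bar>g \<theta> y\<bar> \<le> c * (1 + (norm y)\<^sup>2)" "c \<ge> 0"
    using g_quadratic_growth[of \<theta>] by blast
  show ?thesis
    by (rule Bochner_Integration.integrable_bound[of _ "\<lambda>x. c * (1 + (norm x)\<^sup>2)"])
       (use c moment_mu in auto)
qed

text \<open>The envelope lies between \<open>g \<theta> (y_star g \<theta> z)\<close> and
  \<open>g \<theta> z\<close>. Both are quadratically bounded in \<open>z\<close>, the former
  because a nonexpansive map grows at most linearly.\<close>

lemma integrable_env: "integrable \<nu> (env \<theta>)"
proof -
  obtain c where c: "\<And>y. \<bar>g \<theta> y\<bar> \<le> c * (1 + (norm y)\<^sup>2)" "c \<ge> 0"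
    using g_quadratic_growth[of \<theta>] by blast
  let ?a = "norm (y_star g \<theta> 0)"
  let ?b = "\<lambda>z. c * (1 + 2 * ?a\<^sup>2 + 2 * (norm z)\<^sup>2)"
  have "norm (env \<theta> z) \<le> norm (?b z)" for z
  proof -
    have "norm (y_star g \<theta> z) \<le> ?a + norm z"
      using y_star_nonexpansive[of g \<theta> z 0, OF convex] norm_triangle_sub[of "y_star g \<theta> z" "y_star g \<theta> 0"]
      by simp
    then have "(norm (y_star g \<theta> z))\<^sup>2 \<le> (?a + norm z)\<^sup>2" by (intro power_mono) auto
    also have "\<dots> \<le> 2 * ?a\<^sup>2 + 2 * (norm z)\<^sup>2"
      using sum_squares_bound[of ?a "norm z"] by (simp add: power2_sum)
    finally have "c * (1 + (norm (y_star g \<theta> z))\<^sup>2) \<le> ?b z"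
      using c(2) by (intro mult_left_mono) auto
    moreover have "g \<theta> (y_star g \<theta> z) \<le> env \<theta> z" unfolding env_def prox_objective_def by simp
    ultimately have "- ?b z \<le> env \<theta> z"
      using c(1)[of "y_star g \<theta> z"] by linarith
    moreover have "env \<theta> z \<le> g \<theta> z" using env_le[of \<theta> z z] by (simp add: prox_objective_def)
    moreover have "g \<theta> z \<le> ?b z"
    proof -
      have "c * (1 + (norm z)\<^sup>2) \<le> ?b z" using c(2) by (intro mult_left_mono) auto
      then show ?thesis using c(1)[of z] by linarith
    qed
    ultimately show ?thesis by simp
  qed
  then show ?thesis
    by (intro Bochner_Integration.integrable_bound[of _ ?b "env \<theta>"]) (use moment_nu in auto)
qed

lemma loss_eq: "loss \<mu> \<nu> g \<theta> = (LINT x|\<mu>. g \<theta> x) - (LINT z|\<nu>. env \<theta> z)"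
  unfolding loss_def env_def prox_objective_def ..

lemmas integral_grad_mu = mu.norm_integral_le_sqrt[OF _ grad_mu, simplified]
lemmas integral_grad_nu = nu.norm_integral_le_sqrt[OF _ grad_nu, simplified]

text \<open>Defined by integrals, so that it is available before the loss is known to be
  differentiable; \<open>gradient_loss\<close> identifies it with the gradient.\<close>

definition loss_grad :: "real^'p \<Rightarrow> real^'p" where
  "loss_grad \<theta> = (LINT x|\<mu>. grad_theta g \<theta> x) - (LINT z|\<nu>. grad_theta g \<theta> (y_star g \<theta> z))"

text \<open>The pointwise remainders are uniform in \<open>x\<close> and \<open>z\<close>, so they
  survive integration: \<open>L\<close> comes from the potential and \<open>L + L\<^sup>2\<close>
  from the envelope. This replaces differentiation under the integral sign.\<close>

lemma loss_remainder:
  "\<bar>loss \<mu> \<nu> g (\<theta> + \<delta>) - loss \<mu> \<nu> g \<theta> - inner \<delta> (loss_grad \<theta>)\<bar> \<le> (2 * L + L\<^sup>2) * (norm \<delta>)\<^sup>2"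
proof -
  let ?r = "\<lambda>x. g (\<theta> + \<delta>) x - g \<theta> x - inner \<delta> (grad_theta g \<theta> x)"
  let ?s = "\<lambda>z. env (\<theta> + \<delta>) z - env \<theta> z - inner \<delta> (grad_theta g \<theta> (y_star g \<theta> z))"
  have r: "(LINT x|\<mu>. ?r x) = (LINT x|\<mu>. g (\<theta> + \<delta>) x) - (LINT x|\<mu>. g \<theta> x)
      - inner \<delta> (LINT x|\<mu>. grad_theta g \<theta> x)" and int_r: "integrable \<mu> ?r"
    using integrable_g integral_grad_mu(1) by (simp_all add: integral_inner_right)
  have s: "(LINT z|\<nu>. ?s z) = (LINT z|\<nu>. env (\<theta> + \<delta>) z) - (LINT z|\<nu>. env \<theta> z)
      - inner \<delta> (LINT z|\<nu>. grad_theta g \<theta> (y_star g \<theta> z))" and int_s: "integrable \<nu> ?s"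
    using integrable_env integral_grad_nu(1) by (simp_all add: integral_inner_right)
  have "\<bar>LINT x|\<mu>. ?r x\<bar> \<le> (LINT x|\<mu>. \<bar>?r x\<bar>)" by (rule integral_abs_bound)
  also have "\<dots> \<le> (LINT x|\<mu>. L * (norm \<delta>)\<^sup>2)"
    using int_r by (intro integral_mono g_remainder_theta) auto
  finally have "\<bar>LINT x|\<mu>. ?r x\<bar> \<le> L * (norm \<delta>)\<^sup>2" by (simp add: mu.prob_space)
  moreover have "\<bar>LINT z|\<nu>. ?s z\<bar> \<le> (LINT z|\<nu>. \<bar>?s z\<bar>)" by (rule integral_abs_bound)
  then have "\<bar>LINT z|\<nu>. ?s z\<bar> \<le> (LINT z|\<nu>. (L + L\<^sup>2) * (norm \<delta>)\<^sup>2)"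
    using int_s by (elim order_trans) (intro integral_mono env_remainder, auto)
  then have "\<bar>LINT z|\<nu>. ?s z\<bar> \<le> (L + L\<^sup>2) * (norm \<delta>)\<^sup>2" by (simp add: nu.prob_space)
  ultimately show ?thesis
    unfolding r s loss_eq loss_grad_def by (simp add: inner_diff_right algebra_simps)
qed

lemma gradient_loss: "gradient (loss \<mu> \<nu> g) = loss_grad"
  using gradient_eqI[OF GDERIV_quadratic_remainder[OF loss_remainder]] by blast

lemmas borel_measurable_loss [measurable] = borel_measurable_gradient[OF loss_remainder]

lemma norm_loss_grad_le: "norm (loss_grad \<theta>) \<le> sqrt M\<^sub>x + sqrt M\<^sub>z"
  unfolding loss_grad_def
  by (intro order_trans[OF norm_triangle_ineq4] add_mono integral_grad_mu(2) integral_grad_nu(2))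

text \<open>Weak duality: minus the loss is at most the transport cost of the product coupling.\<close>

lemma loss_bounded_below:
  "- ((LINT x|\<mu>. (norm x)\<^sup>2) + (LINT z|\<nu>. (norm z)\<^sup>2)) \<le> loss \<mu> \<nu> g \<theta>"
proof -
  let ?m = "LINT z|\<nu>. (norm z)\<^sup>2"
  have "(LINT z|\<nu>. env \<theta> z) \<le> (norm x)\<^sup>2 + g \<theta> x + ?m" for x
  proof -
    \<comment> \<open>The point \<open>x\<close> competes in the prox problem at \<open>z\<close>;
      its cost is split so that \<open>x\<close> and \<open>z\<close> separate.\<close>
    have "env \<theta> z \<le> ((norm x)\<^sup>2 + g \<theta> x) + (norm z)\<^sup>2" for z
    proof -
      have "(norm (x - z))\<^sup>2 \<le> (norm x + norm z)\<^sup>2"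
        by (intro power_mono norm_triangle_ineq4) auto
      also have "\<dots> \<le> 2 * (norm x)\<^sup>2 + 2 * (norm z)\<^sup>2"
        using sum_squares_bound[of "norm x" "norm z"] by (simp add: power2_sum)
      finally show ?thesis using env_le[of \<theta> z x] by (simp add: prox_objective_def)
    qed
    then have "(LINT z|\<nu>. env \<theta> z) \<le> (LINT z|\<nu>. ((norm x)\<^sup>2 + g \<theta> x) + (norm z)\<^sup>2)"
      using integrable_env moment_nu by (intro integral_mono) auto
    then show ?thesis using moment_nu by (simp add: nu.prob_space)
  qed
  then have "(LINT x|\<mu>. (LINT z|\<nu>. env \<theta> z)) \<le> (LINT x|\<mu>. (norm x)\<^sup>2 + g \<theta> x + ?m)"
    using integrable_g moment_mu by (intro integral_mono) auto
  then show ?thesis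
    using integrable_g moment_mu by (simp add: loss_eq mu.prob_space)
qed

end

section \<open>The stochastic direction\<close>

text \<open>All quantities are computed from the common marginal law: the mean by linearity, the
  second moment by Jensen's inequality for the average over the batch.\<close>

lemma (in prob_space) batch_mean:
  fixes f :: "'b::euclidean_space \<Rightarrow> 'c::euclidean_space"
  assumes I: "finite I" "I \<noteq> {}"
    and X: "\<forall>i\<in>I. X i \<in> borel_measurable M"
    and law: "\<forall>i\<in>I. distr M borel (X i) = \<mu>"
    and f [measurable]: "f \<in> borel_measurable borel"
    and int: "integrable \<mu> f" and int2: "integrable \<mu> (\<lambda>x. (norm (f x))\<^sup>2)"
  defines "m \<equiv> \<lambda>w. (1 / real (card I)) *\<^sub>R (\<Sum>i\<in>I. f (X i w))"
  shows "integrable M m" and "(LINT w|M. m w) = (LINT x|\<mu>. f x)"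
    and "integrable M (\<lambda>w. (norm (m w))\<^sup>2)"
    and "(LINT w|M. (norm (m w))\<^sup>2) \<le> (LINT x|\<mu>. (norm (f x))\<^sup>2)"
proof -
  have card: "real (card I) \<noteq> 0" using I by simp
  have intX: "integrable M (\<lambda>w. h (X i w))" and lawX: "(LINT w|M. h (X i w)) = (LINT x|\<mu>. h x)"
    if "i \<in> I" and h: "integrable \<mu> h" "h \<in> borel_measurable borel" for i and h :: "'b \<Rightarrow> 'e::euclidean_space"
    using integrable_distr_eq[of "X i" M borel h] integral_distr[of "X i" M borel h] X law that
    by simp_all
  show int_m: "integrable M m"
    unfolding m_def using int by (intro integrable_scaleR_right Bochner_Integration.integrable_sum intX) auto
  show "(LINT w|M. m w) = (LINT x|\<mu>. f x)"
  proof -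
    have "(LINT w|M. (\<Sum>i\<in>I. f (X i w))) = (\<Sum>i\<in>I. LINT w|M. f (X i w))"
      by (intro Bochner_Integration.integral_sum intX int f)
    also have "\<dots> = real (card I) *\<^sub>R (LINT x|\<mu>. f x)"
      using lawX[OF _ int f] by (simp add: sum_constant_scaleR)
    finally show ?thesis unfolding m_def using card by simp
  qed
  let ?b = "\<lambda>w. 1 / real (card I) * (\<Sum>i\<in>I. (norm (f (X i w)))\<^sup>2)"
  have int_b: "integrable M ?b"
    using int2 intX[of _ "\<lambda>x. (norm (f x))\<^sup>2"]
    by (intro integrable_mult_right Bochner_Integration.integrable_sum) auto
  have le_b: "(norm (m w))\<^sup>2 \<le> ?b w" for w
    unfolding m_def using I by (rule norm_mean_squared_le)
  show int_m2: "integrable M (\<lambda>w. (norm (m w))\<^sup>2)"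
  proof (rule Bochner_Integration.integrable_bound[OF int_b])
    show "(\<lambda>w. (norm (m w))\<^sup>2) \<in> borel_measurable M" using int_m by measurable
    have "norm ((norm (m w))\<^sup>2) \<le> norm (?b w)" for w
      using le_b[of w] by (simp add: abs_of_nonneg sum_nonneg)
    then show "AE w in M. norm ((norm (m w))\<^sup>2) \<le> norm (?b w)" by simp
  qed
  have "(LINT w|M. (norm (m w))\<^sup>2) \<le> (LINT w|M. ?b w)"
    using int_m2 int_b le_b by (intro integral_mono) auto
  also have "\<dots> = (LINT x|\<mu>. (norm (f x))\<^sup>2)"
    using int2 intX[of _ "\<lambda>x. (norm (f x))\<^sup>2"] lawX[of _ "\<lambda>x. (norm (f x))\<^sup>2"] card
    by (simp add: Bochner_Integration.integral_sum)
  finally show "(LINT w|M. (norm (m w))\<^sup>2) \<le> (LINT x|\<mu>. (norm (f x))\<^sup>2)" .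
qed

text \<open>Independence makes the joint law a product, and Tonelli's theorem applies. Nonnegative
  integrals allow its use on the shifted loss before that is known to have finite
  expectation.\<close>

lemma (in prob_space) nn_integral_indep_var:
  assumes ind: "indep_var S X T Y" and F [measurable]: "F \<in> borel_measurable (S \<Otimes>\<^sub>M T)"
  shows "(\<integral>\<^sup>+w. F (X w, Y w) \<partial>M) = (\<integral>\<^sup>+w. (\<integral>\<^sup>+w'. F (X w, Y w') \<partial>M) \<partial>M)"
proof -
  note [measurable] = indep_var_rv1[OF ind] indep_var_rv2[OF ind]
  interpret Y: prob_space "distr M T Y" by (rule prob_space_distr) measurable
  have F': "F \<in> borel_measurable (distr M S X \<Otimes>\<^sub>M distr M T Y)" by measurable
  have "(\<integral>\<^sup>+w. F (X w, Y w) \<partial>M) = (\<integral>\<^sup>+p. F p \<partial>distr M (S \<Otimes>\<^sub>M T) (\<lambda>w. (X w, Y w)))"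
    by (subst nn_integral_distr) auto
  also have "\<dots> = (\<integral>\<^sup>+p. F p \<partial>(distr M S X \<Otimes>\<^sub>M distr M T Y))"
    using ind unfolding indep_var_distribution_eq by simp
  also have "\<dots> = (\<integral>\<^sup>+x. (\<integral>\<^sup>+y. F (x, y) \<partial>distr M T Y) \<partial>distr M S X)"
    using Y.nn_integral_fst[OF F'] by simp
  also have "\<dots> = (\<integral>\<^sup>+x. (\<integral>\<^sup>+w'. F (x, Y w') \<partial>M) \<partial>distr M S X)"
    by (intro nn_integral_cong nn_integral_distr) (auto intro: measurable_compose[OF measurable_Pair1' F])
  also have "\<dots> = (\<integral>\<^sup>+w. (\<integral>\<^sup>+w'. F (X w, Y w') \<partial>M) \<partial>M)"
    by (intro nn_integral_distr) measurable
  finally show ?thesis .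
qed

section \<open>Bias, second moment and one-step descent for the approximate direction\<close>

locale approx_prox_loss = prox_loss g L L\<^sub>y \<mu> \<nu> M\<^sub>x M\<^sub>z
  for g :: "real^'p \<Rightarrow> real^'d \<Rightarrow> real" and L L\<^sub>y :: real and \<mu> \<nu> :: "(real^'d) measure"
    and M\<^sub>x M\<^sub>z :: real +
  fixes yt :: "real^'p \<Rightarrow> real^'d \<Rightarrow> real^'d" and B :: nat and V :: real
  assumes yt_measurable: "(\<lambda>(\<theta>, z). yt \<theta> z) \<in> borel_measurable borel"
    and L_pos: "0 < L" and M_pos: "0 < M\<^sub>x" "0 < M\<^sub>z" and V_nonneg: "0 \<le> V" and B_pos: "1 \<le> B"
    and grad_yt: "integrable \<nu> (\<lambda>z. (norm (grad_theta g \<theta> (yt \<theta> z)))\<^sup>2)"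
      "(LINT z|\<nu>. (norm (grad_theta g \<theta> (yt \<theta> z)))\<^sup>2) \<le> M\<^sub>z"
    and yt_error: "norm (yt \<theta> z - y_star g \<theta> z)
      \<le> V * (norm (loss_grad \<theta>))\<^sup>2 / (L * (sqrt M\<^sub>x + sqrt M\<^sub>z))"
begin

lemma borel_measurable_yt [measurable]: "yt \<theta> \<in> borel_measurable borel"
  using measurable_compose[OF measurable_Pair1' yt_measurable[folded borel_prod], of \<theta>] by simp

lemmas integral_grad_yt = nu.norm_integral_le_sqrt[OF _ grad_yt, simplified]

text \<open>The expectation of the stochastic direction at a fixed parameter. It differs from
  \<open>loss_grad\<close> by the bias of using \<open>yt\<close> for \<open>y_star\<close>.\<close>

definition mean_dir :: "real^'p \<Rightarrow> real^'p" where
  "mean_dir \<theta> = (LINT x|\<mu>. grad_theta g \<theta> x) - (LINT z|\<nu>. grad_theta g \<theta> (yt \<theta> z))"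

text \<open>The Lipschitz bound turns the minimizer error into a bias of norm at most
  \<open>V * (norm ?G)\<^sup>2 / ?s\<close>. As \<open>norm ?G\<close> is itself at most
  \<open>?s\<close>, pairing the bias with \<open>?G\<close> costs at most
  \<open>V * (norm ?G)\<^sup>2\<close>.\<close>

lemma inner_mean_dir_ge: "(1 - V) * (norm (loss_grad \<theta>))\<^sup>2 \<le> inner (loss_grad \<theta>) (mean_dir \<theta>)"
proof -
  let ?G = "loss_grad \<theta>" and ?s = "sqrt M\<^sub>x + sqrt M\<^sub>z"
  let ?e = "\<lambda>z. grad_theta g \<theta> (y_star g \<theta> z) - grad_theta g \<theta> (yt \<theta> z)"
  have s: "?s > 0" using M_pos by (simp add: add_pos_pos)
  have int_e: "integrable \<nu> ?e" using integral_grad_nu(1) integral_grad_yt(1) by simp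
  have "mean_dir \<theta> - ?G = (LINT z|\<nu>. ?e z)"
    unfolding mean_dir_def loss_grad_def using integral_grad_nu(1) integral_grad_yt(1) by simp
  also have "norm \<dots> \<le> (LINT z|\<nu>. norm (?e z))" by (rule integral_norm_bound)
  also have "\<dots> \<le> (LINT z|\<nu>. V * (norm ?G)\<^sup>2 / ?s)"
  proof (rule integral_mono)
    fix z
    have "norm (?e z) \<le> L * norm (yt \<theta> z - y_star g \<theta> z)"
      using grad_theta_lipschitz[of \<theta> "y_star g \<theta> z" "yt \<theta> z"] by (simp add: norm_minus_commute)
    also have "\<dots> \<le> L * (V * (norm ?G)\<^sup>2 / (L * ?s))"
      using L_pos by (intro mult_left_mono yt_error) simp
    also have "\<dots> = V * (norm ?G)\<^sup>2 / ?s" using L_pos by simp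
    finally show "norm (?e z) \<le> V * (norm ?G)\<^sup>2 / ?s" .
  qed (use int_e in auto)
  finally have close: "norm (mean_dir \<theta> - ?G) \<le> V * (norm ?G)\<^sup>2 / ?s" by (simp add: nu.prob_space)
  have "- inner ?G (mean_dir \<theta> - ?G) \<le> norm ?G * norm (mean_dir \<theta> - ?G)"
    using Cauchy_Schwarz_ineq2[of ?G "mean_dir \<theta> - ?G"] by linarith
  also have "\<dots> \<le> ?s * (V * (norm ?G)\<^sup>2 / ?s)"
    using close norm_loss_grad_le[of \<theta>] s by (intro mult_mono) auto
  also have "\<dots> = V * (norm ?G)\<^sup>2" using s by simp
  finally show ?thesis by (simp add: inner_diff_right power2_norm_eq_inner algebra_simps)
qed

abbreviation dir :: "'d batch \<Rightarrow> real^'p \<Rightarrow> real^'p" where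
  "dir \<equiv> sgd_direction g yt B"

lemma borel_measurable_dir:
  "(\<lambda>(\<theta>, s). dir s \<theta>) \<in> borel_measurable (borel \<Otimes>\<^sub>M batch_space B)"
proof -
  have [measurable]: "(\<lambda>p. fst (snd p) i) \<in> borel_measurable (borel \<Otimes>\<^sub>M batch_space B)"
    "(\<lambda>p. snd (snd p) i) \<in> borel_measurable (borel \<Otimes>\<^sub>M batch_space B)" if "i \<in> {1..B}"
    for i :: nat
    unfolding batch_space_def using that by measurable
  note [measurable] = borel_measurable_grad_theta yt_measurable[folded borel_prod]
  have *: "(\<lambda>p. grad_theta g (fst p) (fst (snd p) i)) \<in> borel_measurable (borel \<Otimes>\<^sub>M batch_space B)"
    "(\<lambda>p. grad_theta g (fst p) (yt (fst p) (snd (snd p) i))) \<in> borel_measurable (borel \<Otimes>\<^sub>M batch_space B)"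
    if "i \<in> {1..B}" for i
    using that by measurable
  show ?thesis
    unfolding sgd_direction_def case_prod_beta
    by (intro borel_measurable_diff borel_measurable_scaleR borel_measurable_const borel_measurable_sum *)
qed

text \<open>Convexity of the squared norm bounds the second moment by that of a single sample.\<close>

lemma dir_moments:
  assumes "prob_space P"
    and X: "\<forall>i\<in>{1..B}. (\<lambda>w. fst (\<xi> w) i) \<in> borel_measurable P"
      "\<forall>i\<in>{1..B}. distr P borel (\<lambda>w. fst (\<xi> w) i) = \<mu>"
    and Z: "\<forall>i\<in>{1..B}. (\<lambda>w. snd (\<xi> w) i) \<in> borel_measurable P"
      "\<forall>i\<in>{1..B}. distr P borel (\<lambda>w. snd (\<xi> w) i) = \<nu>"
  shows "integrable P (\<lambda>w. dir (\<xi> w) \<theta>)" and "(LINT w|P. dir (\<xi> w) \<theta>) = mean_dir \<theta>"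
    and "integrable P (\<lambda>w. (norm (dir (\<xi> w) \<theta>))\<^sup>2)"
    and "(LINT w|P. (norm (dir (\<xi> w) \<theta>))\<^sup>2) \<le> 2 * (M\<^sub>x + M\<^sub>z)"
proof -
  interpret P: prob_space P by fact
  let ?a = "\<lambda>w. (1 / real B) *\<^sub>R (\<Sum>i=1..B. grad_theta g \<theta> (fst (\<xi> w) i))"
  let ?b = "\<lambda>w. (1 / real B) *\<^sub>R (\<Sum>i=1..B. grad_theta g \<theta> (yt \<theta> (snd (\<xi> w) i)))"
  have I: "finite {1..B}" "{1..B} \<noteq> {}" using B_pos by auto
  have yt: "(\<lambda>z. grad_theta g \<theta> (yt \<theta> z)) \<in> borel_measurable borel" by measurable
  note a = P.batch_mean[OF I X borel_measurable_grad_theta_fixed integral_grad_mu(1) grad_mu(1)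
    , of \<theta>, unfolded card_atLeastAtMost diff_Suc_1]
  note b = P.batch_mean[OF I Z yt integral_grad_yt(1) grad_yt(1)
    , unfolded card_atLeastAtMost diff_Suc_1]
  have dir: "dir (\<xi> w) \<theta> = ?a w - ?b w" for w unfolding sgd_direction_def ..
  show int: "integrable P (\<lambda>w. dir (\<xi> w) \<theta>)"
    unfolding dir using a(1) b(1) by simp
  show "(LINT w|P. dir (\<xi> w) \<theta>) = mean_dir \<theta>"
    unfolding dir mean_dir_def using a(1,2) b(1,2) by simp
  let ?q = "\<lambda>w. 2 * (norm (?a w))\<^sup>2 + 2 * (norm (?b w))\<^sup>2"
  have int_q: "integrable P ?q" using a(3) b(3) by simp
  have le: "(norm (dir (\<xi> w) \<theta>))\<^sup>2 \<le> ?q w" for w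
  proof -
    have "(norm (dir (\<xi> w) \<theta>))\<^sup>2 \<le> (norm (?a w) + norm (?b w))\<^sup>2"
      unfolding dir by (intro power_mono norm_triangle_ineq4) simp
    also have "\<dots> \<le> ?q w"
      using sum_squares_bound[of "norm (?a w)" "norm (?b w)"] by (simp add: power2_sum)
    finally show ?thesis .
  qed
  show int2: "integrable P (\<lambda>w. (norm (dir (\<xi> w) \<theta>))\<^sup>2)"
  proof (rule Bochner_Integration.integrable_bound[OF int_q])
    show "(\<lambda>w. (norm (dir (\<xi> w) \<theta>))\<^sup>2) \<in> borel_measurable P" using int by measurable
    show "AE w in P. norm ((norm (dir (\<xi> w) \<theta>))\<^sup>2) \<le> norm (?q w)" using le by simp
  qed
  have "(LINT w|P. (norm (dir (\<xi> w) \<theta>))\<^sup>2) \<le> (LINT w|P. ?q w)"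
    using int2 int_q le by (intro integral_mono) auto
  also have "\<dots> = 2 * (LINT w|P. (norm (?a w))\<^sup>2) + 2 * (LINT w|P. (norm (?b w))\<^sup>2)"
    using a(3) b(3) by simp
  also have "\<dots> \<le> 2 * (M\<^sub>x + M\<^sub>z)"
    using order_trans[OF a(4) grad_mu(2)] order_trans[OF b(4) grad_yt(2)]
    unfolding distrib_left by (intro add_mono mult_left_mono) auto
  finally show "(LINT w|P. (norm (dir (\<xi> w) \<theta>))\<^sup>2) \<le> 2 * (M\<^sub>x + M\<^sub>z)" .
qed

text \<open>The remainder coefficient of the loss times the bound on the second moment of the
  direction: the error of a step of length \<open>a\<close> is at most
  \<open>a\<^sup>2 * noise\<close>.\<close>

definition noise :: real where
  "noise = (2 * L + L\<^sup>2) * (2 * (M\<^sub>x + M\<^sub>z))"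

lemma noise_nonneg: "0 \<le> noise"
  unfolding noise_def using L_nonneg M_pos by simp

text \<open>The loss shifted by its lower bound to be nonnegative, so that its expectation along the
  chain makes sense as a value in \<open>ennreal\<close>.\<close>

definition gap :: "real^'p \<Rightarrow> real" where
  "gap \<theta> = loss \<mu> \<nu> g \<theta> + ((LINT x|\<mu>. (norm x)\<^sup>2) + (LINT z|\<nu>. (norm z)\<^sup>2))"

lemma gap_nonneg: "0 \<le> gap \<theta>"
  using loss_bounded_below[of \<theta>] unfolding gap_def by linarith

lemma borel_measurable_gap [measurable]: "gap \<in> borel_measurable borel"
  unfolding gap_def by measurable

text \<open>The remainder bound at the displacement
  \<open>- a *\<^sub>R dir (\<xi> w) \<theta>\<close> is averaged: the linear term becomes the inner
  product with \<open>mean_dir\<close>, the quadratic one is the noise. The decrease stands on the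
  left because subtraction in \<open>ennreal\<close> truncates.\<close>

lemma expected_descent:
  assumes "prob_space P"
    and X: "\<forall>i\<in>{1..B}. (\<lambda>w. fst (\<xi> w) i) \<in> borel_measurable P"
      "\<forall>i\<in>{1..B}. distr P borel (\<lambda>w. fst (\<xi> w) i) = \<mu>"
    and Z: "\<forall>i\<in>{1..B}. (\<lambda>w. snd (\<xi> w) i) \<in> borel_measurable P"
      "\<forall>i\<in>{1..B}. distr P borel (\<lambda>w. snd (\<xi> w) i) = \<nu>"
    and a: "0 \<le> a" and V: "V \<le> 1"
  shows "(\<integral>\<^sup>+w. ennreal (gap (\<theta> - a *\<^sub>R dir (\<xi> w) \<theta>)) \<partial>P)
      + ennreal (a * (1 - V)) * ennreal ((norm (loss_grad \<theta>))\<^sup>2)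
    \<le> ennreal (gap \<theta>) + ennreal (a\<^sup>2 * noise)"
proof -
  interpret P: prob_space P by fact
  let ?G = "loss_grad \<theta>"
  note d = dir_moments[OF assms(1) X Z, where \<theta> = \<theta>]
  let ?u = "\<lambda>w. gap \<theta> - a * inner ?G (dir (\<xi> w) \<theta>) + (2 * L + L\<^sup>2) * (a\<^sup>2 * (norm (dir (\<xi> w) \<theta>))\<^sup>2)"
  have le: "gap (\<theta> - a *\<^sub>R dir (\<xi> w) \<theta>) \<le> ?u w" for w
    using loss_remainder[of \<theta> "- a *\<^sub>R dir (\<xi> w) \<theta>"]
    unfolding gap_def by (simp add: power_mult_distrib inner_commute)
  have int: "integrable P ?u" using d(1,3) by simp
  \<comment> \<open>The majorant inherits nonnegativity from \<open>gap\<close>, so its nonnegative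
    integral is a Bochner integral and can be evaluated by linearity.\<close>
  have nonneg: "0 \<le> ?u w" for w using le[of w] gap_nonneg order_trans by blast
  have "(\<integral>\<^sup>+w. ennreal (gap (\<theta> - a *\<^sub>R dir (\<xi> w) \<theta>)) \<partial>P) \<le> (\<integral>\<^sup>+w. ennreal (?u w) \<partial>P)"
    by (intro nn_integral_mono ennreal_leI le)
  also have "\<dots> = ennreal (LINT w|P. ?u w)"
    by (intro nn_integral_eq_integral int AE_I2 nonneg)
  finally have 1: "(\<integral>\<^sup>+w. ennreal (gap (\<theta> - a *\<^sub>R dir (\<xi> w) \<theta>)) \<partial>P) \<le> ennreal (LINT w|P. ?u w)" .
  have "(LINT w|P. ?u w) = gap \<theta> - a * inner ?G (mean_dir \<theta>)
      + (2 * L + L\<^sup>2) * (a\<^sup>2 * (LINT w|P. (norm (dir (\<xi> w) \<theta>))\<^sup>2))"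
    using d(1,3) by (simp add: P.prob_space integral_inner_right d(2))
  also have "\<dots> \<le> gap \<theta> - a * ((1 - V) * (norm ?G)\<^sup>2) + (2 * L + L\<^sup>2) * (a\<^sup>2 * (2 * (M\<^sub>x + M\<^sub>z)))"
    using a L_nonneg inner_mean_dir_ge[of \<theta>] d(4)
    by (intro add_mono diff_mono mult_left_mono order_refl) auto
  finally have "(LINT w|P. ?u w) + a * (1 - V) * (norm ?G)\<^sup>2 \<le> gap \<theta> + a\<^sup>2 * noise"
    unfolding noise_def by (simp add: algebra_simps)
  then have "ennreal ((LINT w|P. ?u w) + a * (1 - V) * (norm ?G)\<^sup>2) \<le> ennreal (gap \<theta> + a\<^sup>2 * noise)"
    by (rule ennreal_leI)
  then have "ennreal (LINT w|P. ?u w) + ennreal (a * (1 - V)) * ennreal ((norm ?G)\<^sup>2)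
      \<le> ennreal (gap \<theta>) + ennreal (a\<^sup>2 * noise)"
    using a V gap_nonneg noise_nonneg Bochner_Integration.integral_nonneg[of P ?u] nonneg
    by (simp add: ennreal_plus ennreal_mult)
  then show ?thesis using 1 by (meson add_right_mono order_trans)
qed

end

section \<open>The iteration\<close>

locale sgd_chain = approx_prox_loss g L L\<^sub>y \<mu> \<nu> M\<^sub>x M\<^sub>z yt B V + P: prob_space P
  for g :: "real^'p \<Rightarrow> real^'d \<Rightarrow> real" and L L\<^sub>y :: real and \<mu> \<nu> :: "(real^'d) measure"
    and M\<^sub>x M\<^sub>z :: real and yt :: "real^'p \<Rightarrow> real^'d \<Rightarrow> real^'d" and B :: nat and V :: real
    and P :: "'w measure" +
  fixes \<xi> :: "nat \<Rightarrow> 'w \<Rightarrow> 'd batch" and \<alpha> :: "nat \<Rightarrow> real" and \<theta>\<^sub>0 :: "real^'p"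
    and \<Theta> :: "nat \<Rightarrow> 'w \<Rightarrow> real^'p"
  assumes V_less: "V < 1" and samples: "sgd_samples P \<mu> \<nu> B \<xi>" and \<alpha>_pos: "0 < \<alpha> j"
    and \<Theta>_0: "w \<in> space P \<Longrightarrow> \<Theta> 0 w = \<theta>\<^sub>0"
    and \<Theta>_Suc: "w \<in> space P \<Longrightarrow> \<Theta> (Suc j) w = \<Theta> j w - \<alpha> j *\<^sub>R dir (\<xi> j w) (\<Theta> j w)"
begin

lemma indep_\<xi>: "P.indep_vars (\<lambda>_. batch_space B) \<xi> UNIV"
  using samples unfolding sgd_samples_def by blast

text \<open>The recursion as a deterministic function of the batch sequence, which exhibits
  \<open>\<Theta> j\<close> as a measurable function of the past batches.\<close>

primrec iterate :: "nat \<Rightarrow> (nat \<Rightarrow> 'd batch) \<Rightarrow> real^'p" where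
  "iterate 0 s = \<theta>\<^sub>0"
| "iterate (Suc j) s = iterate j s - \<alpha> j *\<^sub>R dir (s j) (iterate j s)"

lemma \<Theta>_eq_iterate:
  assumes "w \<in> space P" and "j \<le> k"
  shows "\<Theta> j w = iterate j (\<lambda>i\<in>{..<k}. \<xi> i w)"
  using assms(2) by (induction j) (simp_all add: \<Theta>_0 \<Theta>_Suc assms(1))

lemma borel_measurable_iterate:
  assumes "j \<le> k"
  shows "iterate j \<in> borel_measurable (\<Pi>\<^sub>M i\<in>{..<k}. batch_space B)"
  using assms
proof (induction j)
  case (Suc j)
  then have [measurable]: "iterate j \<in> borel_measurable (\<Pi>\<^sub>M i\<in>{..<k}. batch_space B)"
    and [measurable]: "(\<lambda>s. s j) \<in> (\<Pi>\<^sub>M i\<in>{..<k}. batch_space B) \<rightarrow>\<^sub>M batch_space B"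
    by (auto intro: measurable_component_singleton)
  have "(\<lambda>s. dir (s j) (iterate j s)) \<in> borel_measurable (\<Pi>\<^sub>M i\<in>{..<k}. batch_space B)"
    using measurable_compose[OF _ borel_measurable_dir, of "\<lambda>s. (iterate j s, s j)"] by simp
  then show ?case by simp
next
  case 0
  have "iterate 0 = (\<lambda>_. \<theta>\<^sub>0)" by (rule ext) simp
  then show ?case by simp
qed

lemma indep_batches:
  "P.indep_var (\<Pi>\<^sub>M i\<in>{..<j}. batch_space B) (\<lambda>w. \<lambda>i\<in>{..<j}. \<xi> i w)
     (\<Pi>\<^sub>M i\<in>{j}. batch_space B) (\<lambda>w. \<lambda>i\<in>{j}. \<xi> i w)"
  by (rule P.indep_var_restrict[OF indep_\<xi>]) auto

lemma borel_measurable_\<Theta> [measurable]: "\<Theta> j \<in> borel_measurable P"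
proof -
  have "(\<lambda>w. iterate j (\<lambda>i\<in>{..<j}. \<xi> i w)) \<in> borel_measurable P"
    using P.indep_var_rv1[OF indep_batches] borel_measurable_iterate[OF order_refl]
    by (rule measurable_compose)
  then show ?thesis using \<Theta>_eq_iterate[of _ j j] by (simp cong: measurable_cong)
qed

lemma batch_laws:
  "\<forall>i\<in>{1..B}. (\<lambda>w. fst (\<xi> j w) i) \<in> borel_measurable P"
  "\<forall>i\<in>{1..B}. distr P borel (\<lambda>w. fst (\<xi> j w) i) = \<mu>"
  "\<forall>i\<in>{1..B}. (\<lambda>w. snd (\<xi> j w) i) \<in> borel_measurable P"
  "\<forall>i\<in>{1..B}. distr P borel (\<lambda>w. snd (\<xi> j w) i) = \<nu>"
  using samples unfolding sgd_samples_def P.indep_vars_def by auto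

text \<open>Conditioning on the past: \<open>\<Theta> j\<close> depends on the batches before
  \<open>j\<close>, hence is independent of batch \<open>j\<close>. The descent estimate for a fixed
  parameter holds at each value of \<open>\<Theta> j\<close> and is then integrated.\<close>

lemma sgd_step:
  "(\<integral>\<^sup>+w. ennreal (gap (\<Theta> (Suc j) w)) \<partial>P)
      + ennreal (\<alpha> j * (1 - V)) * (\<integral>\<^sup>+w. ennreal ((norm (loss_grad (\<Theta> j w)))\<^sup>2) \<partial>P)
    \<le> (\<integral>\<^sup>+w. ennreal (gap (\<Theta> j w)) \<partial>P) + ennreal ((\<alpha> j)\<^sup>2 * noise)"
proof -
  let ?F = "\<lambda>(\<theta>, s). ennreal (gap (\<theta> - \<alpha> j *\<^sub>R dir s \<theta>))"
  let ?q = "\<lambda>w. ennreal ((norm (loss_grad (\<Theta> j w)))\<^sup>2)"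
  let ?past = "\<lambda>w. \<lambda>i\<in>{..<j}. \<xi> i w" and ?now = "\<lambda>w. \<lambda>i\<in>{j}. \<xi> i w"
  note [measurable] = borel_measurable_dir borel_measurable_iterate[of j j, OF order_refl]
  have [measurable]: "(\<lambda>t. t j) \<in> (\<Pi>\<^sub>M i\<in>{j}. batch_space B) \<rightarrow>\<^sub>M batch_space B"
    by (rule measurable_component_singleton) simp
  have F [measurable]: "?F \<in> borel_measurable (borel \<Otimes>\<^sub>M batch_space B)" by measurable
  have FI: "(\<lambda>(s, t). ?F (iterate j s, t j))
      \<in> borel_measurable ((\<Pi>\<^sub>M i\<in>{..<j}. batch_space B) \<Otimes>\<^sub>M (\<Pi>\<^sub>M i\<in>{j}. batch_space B))"
    by measurable
  have [measurable]: "\<xi> j \<in> P \<rightarrow>\<^sub>M batch_space B"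
    using indep_\<xi> unfolding P.indep_vars_def by auto
  have [measurable]: "(\<lambda>w. \<integral>\<^sup>+w'. ?F (\<Theta> j w, \<xi> j w') \<partial>P) \<in> borel_measurable P"
    by measurable
  have "(\<integral>\<^sup>+w. ennreal (gap (\<Theta> (Suc j) w)) \<partial>P)
      = (\<integral>\<^sup>+w. (\<lambda>(s, t). ?F (iterate j s, t j)) (?past w, ?now w) \<partial>P)"
    by (intro nn_integral_cong) (simp add: \<Theta>_Suc \<Theta>_eq_iterate[of _ j j])
  also have "\<dots> = (\<integral>\<^sup>+w. (\<integral>\<^sup>+w'. (\<lambda>(s, t). ?F (iterate j s, t j)) (?past w, ?now w') \<partial>P) \<partial>P)"
    by (rule P.nn_integral_indep_var[OF indep_batches FI])
  \<comment> \<open>In the inner integral the parameter is frozen at \<open>\<Theta> j w\<close> and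
    only the fresh batch varies with \<open>w'\<close>.\<close>
  also have "\<dots> = (\<integral>\<^sup>+w. (\<integral>\<^sup>+w'. ?F (\<Theta> j w, \<xi> j w') \<partial>P) \<partial>P)"
    by (intro nn_integral_cong) (simp add: \<Theta>_eq_iterate[of _ j j])
  finally have "(\<integral>\<^sup>+w. ennreal (gap (\<Theta> (Suc j) w)) \<partial>P) + ennreal (\<alpha> j * (1 - V)) * (\<integral>\<^sup>+w. ?q w \<partial>P)
      = (\<integral>\<^sup>+w. (\<integral>\<^sup>+w'. ?F (\<Theta> j w, \<xi> j w') \<partial>P) + ennreal (\<alpha> j * (1 - V)) * ?q w \<partial>P)"
    by (simp add: nn_integral_add nn_integral_cmult)
  also have "\<dots> \<le> (\<integral>\<^sup>+w. ennreal (gap (\<Theta> j w)) + ennreal ((\<alpha> j)\<^sup>2 * noise) \<partial>P)"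
    unfolding prod.case
    using expected_descent[OF P.prob_space_axioms batch_laws] \<alpha>_pos[of j] V_less
    by (intro nn_integral_mono) simp
  also have "\<dots> = (\<integral>\<^sup>+w. ennreal (gap (\<Theta> j w)) \<partial>P) + ennreal ((\<alpha> j)\<^sup>2 * noise)"
    by (simp add: nn_integral_add P.emeasure_space_1)
  finally show ?thesis .
qed

lemma integrable_loss_grad_squared: "integrable P (\<lambda>w. (norm (loss_grad (\<Theta> j w)))\<^sup>2)"
proof (rule P.integrable_const_bound)
  show "AE w in P. norm ((norm (loss_grad (\<Theta> j w)))\<^sup>2) \<le> (sqrt M\<^sub>x + sqrt M\<^sub>z)\<^sup>2"
    using norm_loss_grad_le by (simp add: power_mono)
qed measurable

text \<open>The one-step inequalities telescope. The induction adds them within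
  \<open>ennreal\<close>, keeping the expected gap on the left, so finiteness of that expectation
  comes out as a by-product.\<close>

lemma weighted_gradient_sum_le:
  assumes "summable (\<lambda>j. (\<alpha> j)\<^sup>2)"
  shows "(\<Sum>j<K. \<alpha> j * (LINT w|P. (norm (loss_grad (\<Theta> j w)))\<^sup>2))
    \<le> (gap \<theta>\<^sub>0 + noise * (\<Sum>j. (\<alpha> j)\<^sup>2)) / (1 - V)"
proof -
  let ?Q = "\<lambda>j. LINT w|P. (norm (loss_grad (\<Theta> j w)))\<^sup>2"
  let ?e = "\<lambda>j. \<integral>\<^sup>+w. ennreal (gap (\<Theta> j w)) \<partial>P"
  have Q: "(\<integral>\<^sup>+w. ennreal ((norm (loss_grad (\<Theta> j w)))\<^sup>2) \<partial>P) = ennreal (?Q j)" for j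
    using integrable_loss_grad_squared by (intro nn_integral_eq_integral) auto
  have Q_nonneg: "0 \<le> ?Q j" for j by simp
  have summand_nonneg: "0 \<le> \<alpha> j * (1 - V) * ?Q j" for j
    using \<alpha>_pos[of j] V_less by (intro mult_nonneg_nonneg Q_nonneg) auto
  have step: "?e (Suc j) + ennreal (\<alpha> j * (1 - V) * ?Q j) \<le> ?e j + ennreal ((\<alpha> j)\<^sup>2 * noise)" for j
    using sgd_step[of j] \<alpha>_pos[of j] V_less unfolding Q by (simp add: ennreal_mult)
  have "?e K + ennreal (\<Sum>j<K. \<alpha> j * (1 - V) * ?Q j) \<le> ennreal (gap \<theta>\<^sub>0 + (\<Sum>j<K. (\<alpha> j)\<^sup>2 * noise))"
  proof (induction K)
    case 0
    have "?e 0 = (\<integral>\<^sup>+w. ennreal (gap \<theta>\<^sub>0) \<partial>P)" by (intro nn_integral_cong) (simp add: \<Theta>_0)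
    then show ?case by (simp add: P.emeasure_space_1)
  next
    case (Suc K)
    let ?s = "\<Sum>j<K. \<alpha> j * (1 - V) * ?Q j" and ?r = "gap \<theta>\<^sub>0 + (\<Sum>j<K. (\<alpha> j)\<^sup>2 * noise)"
    have r: "0 \<le> ?r" using gap_nonneg noise_nonneg by (intro add_nonneg_nonneg sum_nonneg) auto
    have "?e (Suc K) + ennreal (\<Sum>j<Suc K. \<alpha> j * (1 - V) * ?Q j)
        = ennreal ?s + (?e (Suc K) + ennreal (\<alpha> K * (1 - V) * ?Q K))"
      using summand_nonneg by (simp add: ennreal_plus sum_nonneg ac_simps)
    also have "\<dots> \<le> ennreal ?s + (?e K + ennreal ((\<alpha> K)\<^sup>2 * noise))"
      by (intro add_left_mono step)
    also have "\<dots> = (?e K + ennreal ?s) + ennreal ((\<alpha> K)\<^sup>2 * noise)" by (simp add: ac_simps)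
    also have "\<dots> \<le> ennreal ?r + ennreal ((\<alpha> K)\<^sup>2 * noise)" by (intro add_right_mono Suc.IH)
    also have "\<dots> = ennreal (?r + (\<alpha> K)\<^sup>2 * noise)"
      using r noise_nonneg by (intro ennreal_plus[symmetric]) auto
    finally show ?case by (simp add: add.assoc)
  qed
  \<comment> \<open>The final gap \<open>?e K\<close> is nonnegative and is dropped.\<close>
  then have "ennreal (\<Sum>j<K. \<alpha> j * (1 - V) * ?Q j) \<le> ennreal (gap \<theta>\<^sub>0 + (\<Sum>j<K. (\<alpha> j)\<^sup>2 * noise))"
    by (rule order_trans[rotated]) simp
  then have "(\<Sum>j<K. \<alpha> j * (1 - V) * ?Q j) \<le> gap \<theta>\<^sub>0 + (\<Sum>j<K. (\<alpha> j)\<^sup>2 * noise)"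
    using gap_nonneg noise_nonneg by (subst (asm) ennreal_le_iff) (auto intro!: add_nonneg_nonneg sum_nonneg)
  also have "(\<Sum>j<K. (\<alpha> j)\<^sup>2 * noise) = noise * (\<Sum>j<K. (\<alpha> j)\<^sup>2)"
    by (simp add: sum_distrib_left mult.commute)
  also have "\<dots> \<le> noise * (\<Sum>j. (\<alpha> j)\<^sup>2)"
    using assms noise_nonneg by (intro mult_left_mono sum_le_suminf) auto
  finally have "(1 - V) * (\<Sum>j<K. \<alpha> j * ?Q j) \<le> gap \<theta>\<^sub>0 + noise * (\<Sum>j. (\<alpha> j)\<^sup>2)"
    by (simp add: sum_distrib_left ac_simps)
  then show ?thesis using V_less by (simp add: field_simps)
qed

lemma averaged_gradient_tendsto_0:
  assumes sq: "summable (\<lambda>j. (\<alpha> j)\<^sup>2)"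
    and div: "filterlim (\<lambda>K. \<Sum>j<K. \<alpha> j) at_top sequentially"
  shows "(\<lambda>K. LINT w|P. 1 / (\<Sum>j<K. \<alpha> j) *
    (\<Sum>j=0..K. \<alpha> j * (norm (gradient (loss \<mu> \<nu> g) (\<Theta> j w)))\<^sup>2)) \<longlonglongrightarrow> 0"
proof -
  let ?A = "\<lambda>K. \<Sum>j<K. \<alpha> j"
  \<comment> \<open>The average has \<open>K + 1\<close> summands over a normalizer with
    \<open>K\<close>. The extra one is harmless, since \<open>?R\<close> bounds the sum for every
    number of terms.\<close>
  let ?S = "\<lambda>K. \<Sum>j<Suc K. \<alpha> j * (LINT w|P. (norm (loss_grad (\<Theta> j w)))\<^sup>2)"
  let ?R = "(gap \<theta>\<^sub>0 + noise * (\<Sum>j. (\<alpha> j)\<^sup>2)) / (1 - V)"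
  have eq: "(LINT w|P. 1 / ?A K * (\<Sum>j=0..K. \<alpha> j * (norm (gradient (loss \<mu> \<nu> g) (\<Theta> j w)))\<^sup>2))
      = ?S K / ?A K" for K
    using integrable_loss_grad_squared
    by (simp add: gradient_loss atLeast0AtMost lessThan_Suc_atMost)
  have "norm (?S K / ?A K) \<le> ?R / ?A K" for K
  proof -
    have "0 \<le> ?A K" "0 \<le> ?S K"
      using \<alpha>_pos by (auto intro!: sum_nonneg mult_nonneg_nonneg simp: less_imp_le simp del: sum.lessThan_Suc)
    then have "norm (?S K / ?A K) = ?S K / ?A K" by (simp only: real_norm_def abs_of_nonneg divide_nonneg_nonneg)
    also have "\<dots> \<le> ?R / ?A K"
      \<comment> \<open>At \<open>K = 0\<close> the normalizer vanishes and both quotients are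
        \<open>0\<close> by convention.\<close>
      by (rule divide_right_mono[OF weighted_gradient_sum_le[OF sq] \<open>0 \<le> ?A K\<close>])
    finally show ?thesis .
  qed
  then have "\<forall>\<^sub>F K in sequentially. norm (?S K / ?A K) \<le> ?R / ?A K" by simp
  moreover have "(\<lambda>K. ?R / ?A K) \<longlonglongrightarrow> 0"
    by (rule real_tendsto_divide_at_top[OF tendsto_const div])
  ultimately show ?thesis unfolding eq by (rule Lim_null_comparison)
qed

end

theorem theorem3p9:
  fixes \<mu> \<nu> :: "(real^'d) measure"
    and g :: "real^'p \<Rightarrow> real^'d \<Rightarrow> real"
    and y_approx :: "real^'p \<Rightarrow> real^'d \<Rightarrow> real^'d"
    and P :: "'w measure"
    and \<xi> :: "nat \<Rightarrow> 'w \<Rightarrow> 'd batch"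
    and B :: nat
    and \<alpha> :: "nat \<Rightarrow> real"
    and \<theta>\<^sub>0 :: "real^'p"
    and \<Theta> :: "nat \<Rightarrow> 'w \<Rightarrow> real^'p"
    and \<epsilon> :: "real^'p \<Rightarrow> real"
    and S :: "(real^'p) set"
    and L_inf L\<^sub>\<theta> L\<^sub>y M\<^sub>x M\<^sub>z M_tilde M_L \<epsilon>\<^sub>p U V :: real
    and A :: "nat \<Rightarrow> real"
  assumes "prob_space \<mu>" and "sets \<mu> = sets borel"
    and "prob_space \<nu>" and "sets \<nu> = sets borel"
    and "\<forall>\<theta>. convex_on UNIV (g \<theta>)"
    and "(\<lambda>(\<theta>, z). y_approx \<theta> z) \<in> borel_measurable borel"
    and "0 < M\<^sub>x" and "0 < M\<^sub>z" and "0 < M_L"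
    and "\<forall>\<theta>. integrable \<mu> (\<lambda>x. (norm (grad_theta g \<theta> x))\<^sup>2) \<and>
             (LINT x|\<mu>. (norm (grad_theta g \<theta> x))\<^sup>2) < M\<^sub>x"
    and "\<forall>\<theta>. integrable \<nu> (\<lambda>z. (norm (grad_theta g \<theta> (y_approx \<theta> z)))\<^sup>2) \<and>
             (LINT z|\<nu>. (norm (grad_theta g \<theta> (y_approx \<theta> z)))\<^sup>2) < M\<^sub>z"
    and "\<forall>\<theta>. integrable \<nu> (\<lambda>z. (norm (grad_theta g \<theta> (y_star g \<theta> z)))\<^sup>2) \<and>
             (LINT z|\<nu>. (norm (grad_theta g \<theta> (y_star g \<theta> z)))\<^sup>2) < M\<^sub>z"
    and "M_tilde = M\<^sub>x + M\<^sub>z + 2 * sqrt (M\<^sub>x * M\<^sub>z)"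
    and "\<forall>\<theta>. (norm (gradient (loss \<mu> \<nu> g) \<theta>))\<^sup>2 \<le> M_L"
    and "prob_space P" and "1 \<le> B" and "sgd_samples P \<mu> \<nu> B \<xi>"
    and "open S" and "S \<noteq> {}" and "\<forall>\<theta>\<in>S. L_inf \<le> loss \<mu> \<nu> g \<theta>"
    and "C1 (\<lambda>(\<theta>, y). g \<theta> y)"
    and "L\<^sub>\<theta>-lipschitz_on UNIV (\<lambda>(\<theta>, y). grad_theta g \<theta> y)"
    and "L\<^sub>y-lipschitz_on UNIV (\<lambda>(\<theta>, y). grad_y g \<theta> y)"
    and "has_second_partials_theta g"
    and "0 < \<epsilon>\<^sub>p"
    and "\<forall>\<theta> z. norm ((y_approx \<theta> z - z) + grad_y g \<theta> (y_approx \<theta> z)) < \<epsilon>\<^sub>p"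
    and "integrable \<mu> (\<lambda>x. (norm x)\<^sup>2)" and "integrable \<nu> (\<lambda>z. (norm z)\<^sup>2)"
    and "0 < V" and "V < 1"
    and "\<forall>\<theta> z. norm (y_approx \<theta> z - y_star g \<theta> z) < \<epsilon> \<theta>"
    and "\<forall>\<theta>. \<epsilon> \<theta> \<le> V * (norm (gradient (loss \<mu> \<nu> g) \<theta>))\<^sup>2
                     / (L\<^sub>\<theta> * (sqrt M\<^sub>x + sqrt M\<^sub>z))"
    and "U = 1 - V"
    and "\<forall>j. 0 < \<alpha> j" and "decseq \<alpha>"
    and "filterlim (\<lambda>K. \<Sum>j<K. \<alpha> j) at_top sequentially"
    and "summable (\<lambda>j. (\<alpha> j)\<^sup>2)"
    and "0 < \<alpha> 0" and "\<alpha> 0 \<le> U * M_L / (L\<^sub>\<theta> * M_tilde)"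
    and "\<forall>K. A K = (\<Sum>j<K. \<alpha> j)"
    and "\<forall>w\<in>space P. \<Theta> 0 w = \<theta>\<^sub>0"
    and "\<forall>j. \<forall>w\<in>space P.
           \<Theta> (Suc j) w = \<Theta> j w - \<alpha> j *\<^sub>R sgd_direction g y_approx B (\<xi> j w) (\<Theta> j w)"
  shows "(\<lambda>K. LINT w|P. 1 / A K *
            (\<Sum>j=0..K. \<alpha> j * (norm (gradient (loss \<mu> \<nu> g) (\<Theta> j w)))\<^sup>2)) \<longlonglongrightarrow> 0"
proof -
  have lip: "lipschitz_potential g L\<^sub>\<theta> L\<^sub>y"
    using assms(5,21,22,23) by unfold_locales auto
  have loss: "prox_loss g L\<^sub>\<theta> L\<^sub>y \<mu> \<nu> M\<^sub>x M\<^sub>z"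
    using lip assms(1-4,10,12,27,28)
    by (auto simp: prox_loss_def prox_loss_axioms_def less_imp_le)
  interpret prox_loss g L\<^sub>\<theta> L\<^sub>y \<mu> \<nu> M\<^sub>x M\<^sub>z by (rule loss)
  \<comment> \<open>If the constant were \<open>0\<close>, the bound on \<open>\<epsilon>\<close>
    would be a quotient by zero, hence \<open>0\<close>, and no norm could lie strictly below
    it.\<close>
  have L: "L\<^sub>\<theta> \<noteq> 0"
  proof
    assume "L\<^sub>\<theta> = 0"
    then have "\<epsilon> 0 \<le> 0" using assms(32) by (auto dest: spec[of _ 0])
    then show False using assms(31) norm_ge_zero order.strict_trans1 by (metis not_le)
  qed
  have "approx_prox_loss g L\<^sub>\<theta> L\<^sub>y \<mu> \<nu> M\<^sub>x M\<^sub>z y_approx B V"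
  proof
    show "norm (y_approx \<theta> z - y_star g \<theta> z)
        \<le> V * (norm (loss_grad \<theta>))\<^sup>2 / (L\<^sub>\<theta> * (sqrt M\<^sub>x + sqrt M\<^sub>z))" for \<theta> z
      using assms(31,32) unfolding gradient_loss by (meson less_imp_le order_trans)
  qed (use assms L L_nonneg in \<open>auto simp: less_imp_le\<close>)
  then have "sgd_chain g L\<^sub>\<theta> L\<^sub>y \<mu> \<nu> M\<^sub>x M\<^sub>z y_approx B V P \<xi> \<alpha> \<theta>\<^sub>0 \<Theta>"
    using assms by (auto simp: sgd_chain_def sgd_chain_axioms_def)
  from sgd_chain.averaged_gradient_tendsto_0[OF this] show ?thesis
    using assms by simp
qed

end
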